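(* Let $\gamma>\gamma_0$. The linear operator $(\mathcal{A}_{\mathcal{R}},D(\mathcal{A}_{\mathcal{R}}))$ generates (through $-\mathcal{A}_{\mathcal{R}}$, i.e. as the evolution operator of $\frac{du}{dt}+\mathcal{A}_{\mathcal{R}}u=0$) an analytic and exponentially stable semigroup on $H$.
   Context: $H=\ell^2(\mathbb{C})$ (complex sequences indexed by $n\ge 1$) with $(u,v)=\sum_{n\ge1}u_nv_n^*$ and $|u|=(u,u)^{1/2}$. Fix $\lambda>1$, $k_0>0$, $k_n=k_0\lambda^n$, $\nu>0$, and constants $a,b,c$ with $a+b+c=0$. Let $(\phi_n)$ be the canonical basis of $H$. $A\phi_n=k_n^2\phi_n$, with $D(A)=\{u\in H:|Au|<\infty\}$; $V=D(A^{1/2})$ with norm $\|u\|=|A^{1/2}u|$. The map $B$ is $$B(u,v)=-i\sum_{n=1}^\infty\big(ak_{n+1}v_{n+2}u_{n+1}^*+bk_nv_{n+1}u_{n-1}^*+ak_{n-1}u_{n-1}v_{n-2}+bk_{n-1}v_{n-1}u_{n-2}\big)\phi_n,$$ with $u_0=u_{-1}=v_0=v_{-1}=0$ (in these component formulas $^*$ is complex conjugation). $u_e$ is a solution of $\nu Au_e+B(u_e,u_e)=f$. The linearized operator is $\mathcal{A}u=\nu Au+B(u,u_e)+B(u_e,u)$ with $D(\mathcal{A})=D(A)$; $-\mathcal{A}$ generates an analytic $C_0$-semigroup on $H$. $B_1,B_2\in\mathcal{L}(H,H)$, $\gamma>0$. Consider the linear system $\frac{du}{dt}+\mathcal{A}u=B_1U+B_2w$,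 $u(0)=u^0\in H$, with control $U\in L^2(0,\infty;H)$ and disturbance $w\in L^2(0,\infty;H)$, and $$\mathcal{J}(u,U,w)=\frac12\int_0^\infty|u|^2\,dt+\frac12\int_0^\infty|U|^2\,dt-\frac\gamma2\int_0^\infty|w|^2\,dt.$$ Put $P(u^0,w)=\inf_U\mathcal{J}(u,U,w)$ and $P(u^0)=\sup_{w\in L^2(0,\infty;H)}P(u^0,w)$. $\gamma_0>0$ is the threshold such that for $\gamma>\gamma_0$ the supremum is attained at a unique $\hat w$, while for $\gamma<\gamma_0$ it is $+\infty$. For $\gamma>\gamma_0$ let $\hat u$ be the optimal state for $(u^0,\hat w)$ and let $r_{u^0}$ be the associated solution of $-\frac{dr}{dt}+\mathcal{A}^*r=\hat u$, $r(\infty)=0$; $\mathcal{R}\in\mathcal{L}(H)$ is defined by $\mathcal{R}u^0=r_{u^0}(0)$, so that $P(u^0)=\frac12(u^0,\mathcal{R}u^0)$. $\mathcal{R}$ is symmetric, positive and satisfies $$\mathcal{A}^*\mathcal{R}+\mathcal{R}\mathcal{A}+\mathcal{R}B_1B_1^*\mathcal{R}-\frac1\gamma\mathcal{R}B_2B_2^*\mathcal{R}-I=0.$$ The closed loop operator is $\mathcal{A}_{\mathcal{R}}u=\mathcal{A}u+B_1B_1^*\mathcal{R}u$ with $D(\mathcal{A}_{\mathcal{R}})=\{u\in H:\mathcal{A}u+B_1B_1^*\mathcal{R}u\in H\}$. *)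

theory Defs
  imports "HOL-Analysis.Analysis"
begin

section \<open>The Hilbert space \<open>H = \<ell>\<^sup>2(\<complex>)\<close>\<close>

text \<open>
  Sequences are indexed by \<open>n \<ge> 1\<close>. An element is stored as a function on \<^typ>\<open>nat\<close> vanishing
  at \<open>0\<close>, which builds in the convention \<open>u\<^sub>0 = 0\<close>. The convention \<open>u\<^sub>-\<^sub>1 = 0\<close> then comes for
  free from truncated subtraction: for \<open>n = 1\<close> the index \<open>n - 2\<close> is \<open>0\<close>.
\<close>

definition l2_seqs :: "(nat \<Rightarrow> complex) set" where
  "l2_seqs = {u. u 0 = 0 \<and> summable (\<lambda>n. (cmod (u n))\<^sup>2)}"

lemma l2_seqs_0: "(\<lambda>n. 0) \<in> l2_seqs"
  by (simp add: l2_seqs_def)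

lemma l2_seqs_add:
  assumes "u \<in> l2_seqs" "v \<in> l2_seqs"
  shows "(\<lambda>n. u n + v n) \<in> l2_seqs"
proof -
  have le: "(cmod (u n + v n))\<^sup>2 \<le> 2 * (cmod (u n))\<^sup>2 + 2 * (cmod (v n))\<^sup>2" for n
  proof -
    have "(cmod (u n + v n))\<^sup>2 \<le> (cmod (u n) + cmod (v n))\<^sup>2"
      by (intro power_mono norm_triangle_ineq) auto
    also have "\<dots> \<le> 2 * (cmod (u n))\<^sup>2 + 2 * (cmod (v n))\<^sup>2"
      using sum_squares_bound[of "cmod (u n)" "cmod (v n)"]
      by (simp add: power2_sum)
    finally show ?thesis .
  qed
  have "summable (\<lambda>n. 2 * (cmod (u n))\<^sup>2 + 2 * (cmod (v n))\<^sup>2)"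
    using assms by (intro summable_add summable_mult) (auto simp: l2_seqs_def)
  then have "summable (\<lambda>n. (cmod (u n + v n))\<^sup>2)"
    by (rule summable_comparison_test'[where N=0]) (use le in auto)
  then show ?thesis
    using assms by (auto simp: l2_seqs_def)
qed

lemma l2_seqs_scale:
  assumes "u \<in> l2_seqs"
  shows "(\<lambda>n. c * u n) \<in> l2_seqs"
  using assms by (auto simp: l2_seqs_def norm_mult power_mult_distrib intro!: summable_mult)

typedef ell2 = l2_seqs
  morphisms ell2_seq Abs_ell2
  using l2_seqs_0 by blast

setup_lifting type_definition_ell2

lemma ell2_eqI: "(\<And>n. ell2_seq u n = ell2_seq v n) \<Longrightarrow> u = v"
  by (simp add: ell2_seq_inject[symmetric] fun_eq_iff)

lemma ell2_seq_0 [simp]: "ell2_seq u 0 = 0"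
  using ell2_seq[of u] by (simp add: l2_seqs_def)

lemma summable_ell2_seq: "summable (\<lambda>n. (cmod (ell2_seq u n))\<^sup>2)"
  using ell2_seq[of u] by (simp add: l2_seqs_def)

lemma summable_ell2_prod:
  "summable (\<lambda>n. ell2_seq u n * cnj (ell2_seq v n))"
proof (rule summable_norm_cancel, rule summable_comparison_test'[where N=0])
  show "summable (\<lambda>n. (cmod (ell2_seq u n))\<^sup>2 + (cmod (ell2_seq v n))\<^sup>2)"
    by (intro summable_add summable_ell2_seq)
  show "norm (norm (ell2_seq u n * cnj (ell2_seq v n)))
      \<le> (cmod (ell2_seq u n))\<^sup>2 + (cmod (ell2_seq v n))\<^sup>2" for n
  proof -
    have "0 \<le> cmod (ell2_seq u n) * cmod (ell2_seq v n)" by simp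
    with sum_squares_bound[of "cmod (ell2_seq u n)" "cmod (ell2_seq v n)"] show ?thesis
      unfolding norm_mult complex_mod_cnj real_norm_def abs_mult abs_norm_cancel by linarith
  qed
qed

definition ell2_cinner :: "ell2 \<Rightarrow> ell2 \<Rightarrow> complex" where
  "ell2_cinner u v = (\<Sum>n. ell2_seq u n * cnj (ell2_seq v n))"

lemma ell2_cinner_self:
  "ell2_cinner u u = of_real (\<Sum>n. (cmod (ell2_seq u n))\<^sup>2)"
  unfolding ell2_cinner_def complex_norm_square[symmetric]
  by (rule suminf_of_real[OF summable_ell2_seq, symmetric])

text \<open>
  \<open>B\<close> is only real bilinear (it involves complex conjugates), so the linearised operator, the
  semigroup it generates and \<open>\<R>\<close> are real linear but not complex linear. Hence \<open>H\<close> is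
  made a real Hilbert space with inner product \<open>Re (u,v)\<close>; the norm is the usual one.
  Linearity, adjoints and \<open>\<L>(H)\<close> below refer to this real structure.
\<close>

instantiation ell2 :: real_inner
begin

lift_definition zero_ell2 :: ell2 is "\<lambda>n. 0" by (rule l2_seqs_0)

lift_definition plus_ell2 :: "ell2 \<Rightarrow> ell2 \<Rightarrow> ell2" is "\<lambda>u v n. u n + v n"
  by (rule l2_seqs_add)

lift_definition scaleR_ell2 :: "real \<Rightarrow> ell2 \<Rightarrow> ell2" is "\<lambda>r u n. of_real r * u n"
  by (rule l2_seqs_scale)

lift_definition uminus_ell2 :: "ell2 \<Rightarrow> ell2" is "\<lambda>u n. - u n"
  by (simp add: l2_seqs_def)

definition minus_ell2 :: "ell2 \<Rightarrow> ell2 \<Rightarrow> ell2" where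
  "u - v = u + (- v)" for u v :: ell2

definition inner_ell2 :: "ell2 \<Rightarrow> ell2 \<Rightarrow> real" where
  "inner u v = Re (ell2_cinner u v)" for u v :: ell2

definition norm_ell2 :: "ell2 \<Rightarrow> real" where
  "norm u = sqrt (Re (ell2_cinner u u))" for u :: ell2

definition sgn_ell2 :: "ell2 \<Rightarrow> ell2" where
  "sgn u = scaleR (inverse (norm u)) u" for u :: ell2

definition dist_ell2 :: "ell2 \<Rightarrow> ell2 \<Rightarrow> real" where
  "dist u v = norm (u - v)" for u v :: ell2

definition uniformity_ell2 :: "(ell2 \<times> ell2) filter" where
  "uniformity_ell2 = (INF e\<in>{0 <..}. principal {(u, v). dist u v < e})"

definition open_ell2 :: "ell2 set \<Rightarrow> bool" where
  "open_ell2 S = (\<forall>u\<in>S. \<forall>\<^sub>F (u', v) in uniformity. u' = u \<longrightarrow> v \<in> S)"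

instance
proof
  fix u v w :: ell2 and r s :: real
  show "u + v + w = u + (v + w)" by transfer (simp add: add.assoc)
  show "u + v = v + u" by transfer (simp add: add.commute)
  show "0 + u = u" by transfer simp
  show "- u + u = 0" by transfer simp
  show "u - v = u + - v" by (rule minus_ell2_def)
  show "r *\<^sub>R (u + v) = r *\<^sub>R u + r *\<^sub>R v" by transfer (simp add: distrib_left)
  show "(r + s) *\<^sub>R u = r *\<^sub>R u + s *\<^sub>R u" by transfer (simp add: distrib_right)
  show "r *\<^sub>R s *\<^sub>R u = (r * s) *\<^sub>R u" by transfer (simp add: mult.assoc)
  show "1 *\<^sub>R u = u" by transfer simp
  show "sgn u = scaleR (inverse (norm u)) u" by (rule sgn_ell2_def)
  show "dist u v = norm (u - v)" by (rule dist_ell2_def)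
  show "uniformity = (INF e\<in>{0 <..}. principal {(u::ell2, v). dist u v < e})"
    by (rule uniformity_ell2_def)
  show "open S = (\<forall>u\<in>S. \<forall>\<^sub>F (u', v) in uniformity. u' = u \<longrightarrow> v \<in> S)" for S :: "ell2 set"
    by (rule open_ell2_def)
  have inner_sum: "inner u v = (\<Sum>n. Re (ell2_seq u n * cnj (ell2_seq v n)))" for u v
    unfolding inner_ell2_def ell2_cinner_def by (rule Re_suminf[OF summable_ell2_prod])
  have summ: "summable (\<lambda>n. Re (ell2_seq u n * cnj (ell2_seq v n)))" for u v
    by (rule summable_Re[OF summable_ell2_prod])
  show "inner u v = inner v u"
    unfolding inner_sum by (intro suminf_cong) (simp add: mult.commute)
  show "inner (u + v) w = inner u w + inner v w"
    unfolding inner_sum suminf_add[OF summ summ]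
    by (intro suminf_cong) (simp add: plus_ell2.rep_eq algebra_simps)
  show "inner (r *\<^sub>R u) v = r * inner u v"
    unfolding inner_sum suminf_mult[OF summ, symmetric]
    by (intro suminf_cong) (simp add: scaleR_ell2.rep_eq algebra_simps)
  have inner_self: "inner u u = (\<Sum>n. (cmod (ell2_seq u n))\<^sup>2)" for u
    by (simp add: inner_ell2_def ell2_cinner_self)
  show "0 \<le> inner u u"
    unfolding inner_self by (intro suminf_nonneg summable_ell2_seq) simp
  show "inner u u = 0 \<longleftrightarrow> u = 0"
  proof
    assume "inner u u = 0"
    then have "\<forall>n. (cmod (ell2_seq u n))\<^sup>2 = 0"
      unfolding inner_self by (subst (asm) suminf_eq_zero_iff) (auto simp: summable_ell2_seq)
    then show "u = 0" by (intro ell2_eqI) (simp add: zero_ell2.rep_eq)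
  qed (simp add: inner_self zero_ell2.rep_eq)
  show "norm u = sqrt (inner u u)"
    by (simp add: norm_ell2_def inner_ell2_def)
qed

end

lemma minus_ell2_rep: "ell2_seq (u - v) n = ell2_seq u n - ell2_seq v n"
  unfolding minus_ell2_def plus_ell2.rep_eq uminus_ell2.rep_eq by simp

lemma norm_ell2_sq: "(norm u)\<^sup>2 = (\<Sum>n. (cmod (ell2_seq u n))\<^sup>2)" for u :: ell2
  by (simp add: power2_norm_eq_inner inner_ell2_def ell2_cinner_self)

lemma cmod_ell2_seq_le: "cmod (ell2_seq u n) \<le> norm u"
proof -
  have "(cmod (ell2_seq u n))\<^sup>2 \<le> (norm u)\<^sup>2"
    unfolding norm_ell2_sq using sum_le_suminf[OF summable_ell2_seq, of "{n}" u] by simp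
  then show ?thesis by (rule power2_le_imp_le) simp
qed

text \<open>Completeness and second countability are what the Bochner integral of
  \<open>H\<close>-valued functions requires.\<close>

instance ell2 :: complete_space
proof
  fix X :: "nat \<Rightarrow> ell2"
  assume X: "Cauchy X"
  have coord: "Cauchy (\<lambda>m. ell2_seq (X m) n)" for n
  proof (rule metric_CauchyI)
    fix e :: real assume "e > 0"
    then obtain M where M: "\<forall>m\<ge>M. \<forall>k\<ge>M. dist (X m) (X k) < e"
      using metric_CauchyD[OF X \<open>e > 0\<close>] by blast
    have le: "dist (ell2_seq (X m) n) (ell2_seq (X k) n) \<le> dist (X m) (X k)" for m k
      using cmod_ell2_seq_le[of "X m - X k" n] by (simp add: dist_norm minus_ell2_rep)
    show "\<exists>M. \<forall>m\<ge>M. \<forall>k\<ge>M. dist (ell2_seq (X m) n) (ell2_seq (X k) n) < e"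
    proof (intro exI allI impI)
      fix m k assume "M \<le> m" "M \<le> k"
      with M have "dist (X m) (X k) < e" by blast
      with le show "dist (ell2_seq (X m) n) (ell2_seq (X k) n) < e" by (rule le_less_trans)
    qed
  qed
  then have "\<forall>n. \<exists>l. (\<lambda>m. ell2_seq (X m) n) \<longlonglongrightarrow> l"
    by (simp add: Cauchy_convergent_iff convergent_def)
  then obtain y where y: "\<And>n. (\<lambda>m. ell2_seq (X m) n) \<longlonglongrightarrow> y n" by metis
  have y0: "y 0 = 0" using y[of 0] by (simp add: LIMSEQ_const_iff)
  have fin: "\<exists>M. \<forall>m\<ge>M. \<forall>N. (\<Sum>n<N. (cmod (ell2_seq (X m) n - y n))\<^sup>2) \<le> e\<^sup>2"
    if e: "e > 0" for e :: real
  proof -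
    obtain M where M: "\<And>m k. m \<ge> M \<Longrightarrow> k \<ge> M \<Longrightarrow> dist (X m) (X k) < e"
      using metric_CauchyD[OF X e] by blast
    have "(\<Sum>n<N. (cmod (ell2_seq (X m) n - y n))\<^sup>2) \<le> e\<^sup>2" if m: "m \<ge> M" for m N
    proof (rule tendsto_upperbound)
      show "((\<lambda>k. \<Sum>n<N. (cmod (ell2_seq (X m) n - ell2_seq (X k) n))\<^sup>2)
          \<longlongrightarrow> (\<Sum>n<N. (cmod (ell2_seq (X m) n - y n))\<^sup>2)) sequentially"
        by (intro tendsto_intros y)
      show "\<forall>\<^sub>F k in sequentially. (\<Sum>n<N. (cmod (ell2_seq (X m) n - ell2_seq (X k) n))\<^sup>2) \<le> e\<^sup>2"
      proof (rule eventually_sequentiallyI[of M])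
        fix k assume k: "k \<ge> M"
        have "(\<Sum>n<N. (cmod (ell2_seq (X m) n - ell2_seq (X k) n))\<^sup>2) \<le> (norm (X m - X k))\<^sup>2"
          unfolding norm_ell2_sq minus_ell2_rep[symmetric]
          by (rule sum_le_suminf[OF summable_ell2_seq]) auto
        also have "\<dots> \<le> e\<^sup>2"
          using M[OF m k] by (intro power_mono) (auto simp: dist_norm)
        finally show "(\<Sum>n<N. (cmod (ell2_seq (X m) n - ell2_seq (X k) n))\<^sup>2) \<le> e\<^sup>2" .
      qed
    qed simp
    then show ?thesis by blast
  qed
  have diff: "(\<lambda>n. ell2_seq (X m) n - y n) \<in> l2_seqs"
    if "\<forall>N. (\<Sum>n<N. (cmod (ell2_seq (X m) n - y n))\<^sup>2) \<le> C" for m C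
  proof -
    have "summable (\<lambda>n. (cmod (ell2_seq (X m) n - y n))\<^sup>2)"
    proof (rule bounded_imp_summable)
      show "(\<Sum>n\<le>N. (cmod (ell2_seq (X m) n - y n))\<^sup>2) \<le> C" for N
        using spec[OF that, of "Suc N"] by (simp only: lessThan_Suc_atMost)
    qed simp
    then show ?thesis using y0 by (simp add: l2_seqs_def)
  qed
  obtain M1 where "\<forall>N. (\<Sum>n<N. (cmod (ell2_seq (X M1) n - y n))\<^sup>2) \<le> 1\<^sup>2"
    using fin[OF zero_less_one] by blast
  from diff[OF this] have "(\<lambda>n. - 1 * (ell2_seq (X M1) n - y n)) \<in> l2_seqs"
    by (rule l2_seqs_scale)
  from l2_seqs_add[OF ell2_seq[of "X M1"] this] have "y \<in> l2_seqs" by simp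
  then have Y: "ell2_seq (Abs_ell2 y) = y" by (rule Abs_ell2_inverse)
  have "X \<longlonglongrightarrow> Abs_ell2 y"
  proof (rule metric_LIMSEQ_I)
    fix r :: real assume r: "r > 0"
    then obtain M where M: "\<And>m N. m \<ge> M \<Longrightarrow> (\<Sum>n<N. (cmod (ell2_seq (X m) n - y n))\<^sup>2) \<le> (r/2)\<^sup>2"
      using fin[OF half_gt_zero[OF r]] by blast
    have "dist (X m) (Abs_ell2 y) < r" if m: "m \<ge> M" for m
    proof -
      have "(norm (X m - Abs_ell2 y))\<^sup>2 \<le> (r/2)\<^sup>2"
        unfolding norm_ell2_sq using M[OF m]
        by (intro suminf_le_const summable_ell2_seq) (auto simp: minus_ell2_rep Y)
      then have "norm (X m - Abs_ell2 y) \<le> r/2" by (rule power2_le_imp_le) (use r in simp)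
      then show ?thesis using r by (simp add: dist_norm)
    qed
    then show "\<exists>M. \<forall>m\<ge>M. dist (X m) (Abs_ell2 y) < r" by blast
  qed
  then show "convergent X" by (auto simp: convergent_def)
qed

instance ell2 :: banach ..

instance ell2 :: second_countable_topology
proof
  obtain D :: "complex set" where D: "countable D"
      "\<And>X. open X \<Longrightarrow> X \<noteq> {} \<Longrightarrow> \<exists>d\<in>D. d \<in> X"
    using countable_dense_setE[where 'a=complex] by blast
  define emb :: "complex list \<Rightarrow> ell2" where
    "emb l = Abs_ell2 (\<lambda>n. if 0 < n \<and> n < length l then l ! n else 0)" for l
  have emb: "ell2_seq (emb l) n = (if 0 < n \<and> n < length l then l ! n else 0)" for l n
  proof -
    have "(\<lambda>n. if 0 < n \<and> n < length l then l ! n else 0) \<in> l2_seqs"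
    proof -
      have "summable (\<lambda>n. (cmod (if 0 < n \<and> n < length l then l ! n else 0))\<^sup>2)"
        by (rule summable_finite[of "{..<length l}"]) auto
      then show ?thesis by (simp add: l2_seqs_def)
    qed
    then show ?thesis by (simp add: emb_def Abs_ell2_inverse)
  qed
  define E where "E = emb ` lists D"
  have "countable E" unfolding E_def using D(1) by (intro countable_image countable_lists)
  have dense: "\<exists>d\<in>E. dist x d < e" if e: "e > 0" for x :: ell2 and e :: real
  proof -
    let ?f = "\<lambda>n. (cmod (ell2_seq x n))\<^sup>2"
    have "(\<lambda>N. \<Sum>n. ?f (n + N)) \<longlonglongrightarrow> 0"
      by (rule suminf_exist_split2[OF summable_ell2_seq])
    then obtain N where N: "\<bar>\<Sum>n. ?f (n + N)\<bar> < e\<^sup>2 / 2"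
      using e LIMSEQ_D[of "\<lambda>N. \<Sum>n. ?f (n + N)" 0 "e\<^sup>2 / 2"] by force
    define \<delta> where "\<delta> = sqrt (e\<^sup>2 / (2 * (real N + 1)))"
    have \<delta>: "\<delta> > 0" "\<delta>\<^sup>2 = e\<^sup>2 / (2 * (real N + 1))"
      using e by (auto simp: \<delta>_def)
    have "\<forall>n. \<exists>d\<in>D. d \<in> ball (ell2_seq x n) \<delta>"
      using \<delta>(1) by (intro allI D(2)) auto
    then obtain q where q: "\<And>n. q n \<in> D" "\<And>n. dist (ell2_seq x n) (q n) < \<delta>"
      unfolding mem_ball by metis
    define d where "d = emb (map q [0..<N])"
    have "map q [0..<N] \<in> lists D" using q(1) by auto
    then have "d \<in> E" unfolding E_def d_def by (rule imageI)
    have dn: "ell2_seq d n = (if 0 < n \<and> n < N then q n else 0)" for n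
      by (simp add: d_def emb)
    have "(norm (x - d))\<^sup>2 = (\<Sum>n. (cmod (ell2_seq (x - d) (n + N)))\<^sup>2)
        + (\<Sum>n<N. (cmod (ell2_seq (x - d) n))\<^sup>2)"
      unfolding norm_ell2_sq by (rule suminf_split_initial_segment[OF summable_ell2_seq])
    also have "(\<Sum>n. (cmod (ell2_seq (x - d) (n + N)))\<^sup>2) = (\<Sum>n. ?f (n + N))"
      by (intro suminf_cong) (simp add: minus_ell2_rep dn)
    also have "(\<Sum>n<N. (cmod (ell2_seq (x - d) n))\<^sup>2) \<le> (\<Sum>n<N. \<delta>\<^sup>2)"
    proof (rule sum_mono)
      fix n assume n: "n \<in> {..<N}"
      show "(cmod (ell2_seq (x - d) n))\<^sup>2 \<le> \<delta>\<^sup>2"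
        using q(2)[of n] n \<delta>(1)
        by (cases "n = 0") (auto simp: minus_ell2_rep dn dist_norm intro!: power_mono)
    qed
    also have "(\<Sum>n<N. \<delta>\<^sup>2) \<le> e\<^sup>2 / 2"
      using e unfolding \<delta>(2) by (simp add: field_simps)
    finally have "(norm (x - d))\<^sup>2 < e\<^sup>2" using N by simp
    then have "dist x d < e" using e by (simp add: dist_norm power_less_imp_less_base)
    with \<open>d \<in> E\<close> show ?thesis by blast
  qed
  define B where "B = (\<lambda>(d, k). ball d (1 / real (Suc k))) ` (E \<times> (UNIV :: nat set))"
  have "countable B" unfolding B_def using \<open>countable E\<close> by (intro countable_image) auto
  moreover have "topological_basis B"
  proof (rule topological_basisI)
    show "open S" if "S \<in> B" for S using that by (auto simp: B_def)
    show "\<exists>S\<in>B. x \<in> S \<and> S \<subseteq> O'" if "open O'" "x \<in> O'" for O' and x :: ell2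
    proof -
      obtain e where e: "e > 0" "ball x e \<subseteq> O'" using \<open>open O'\<close> \<open>x \<in> O'\<close> open_contains_ball by blast
      obtain k where k: "1 / real (Suc k) < e / 2"
        using e(1) reals_Archimedean[of "e/2"] by (auto simp: inverse_eq_divide)
      obtain d where d: "d \<in> E" "dist x d < 1 / real (Suc k)"
        using dense[of "1 / real (Suc k)" x] by auto
      have "ball d (1 / real (Suc k)) \<subseteq> O'"
      proof
        fix z assume "z \<in> ball d (1 / real (Suc k))"
        then have "dist x z < e"
          using d(2) k dist_triangle[of x z d] by simp
        then show "z \<in> O'" using e(2) by auto
      qed
      moreover have "x \<in> ball d (1 / real (Suc k))" using d(2) by (simp add: dist_commute)
      ultimately show ?thesis using d(1) unfolding B_def by blast
    qed
  qed
  ultimately show "\<exists>B::ell2 set set. countable B \<and> open = generate_topology B"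
    using topological_basis_imp_subbasis by blast
qed


section \<open>Semigroups of operators\<close>

text \<open>An unbounded operator is represented by its graph, so that its domain is \<^const>\<open>Domain\<close>.\<close>

definition op_uminus :: "('a \<times> 'a::real_normed_vector) set \<Rightarrow> ('a \<times> 'a) set" where
  "op_uminus G = {(x, - y) | x y. (x, y) \<in> G}"

definition op_adjoint :: "('a \<times> 'a::real_inner) set \<Rightarrow> ('a \<times> 'a) set" where
  "op_adjoint G = {(v, z). \<forall>(x, y)\<in>G. inner y v = inner x z}"

definition C0_semigroup :: "(real \<Rightarrow> 'a \<Rightarrow> 'a::real_normed_vector) \<Rightarrow> bool" where
  "C0_semigroup T \<longleftrightarrow>
     (\<forall>t\<ge>0. bounded_linear (T t)) \<and> T 0 = id \<and>
     (\<forall>s\<ge>0. \<forall>t\<ge>0. T (s + t) = T s \<circ> T t) \<and>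
     (\<forall>x. ((\<lambda>t. T t x) \<longlongrightarrow> x) (at_right 0))"

definition generator :: "(real \<Rightarrow> 'a \<Rightarrow> 'a::real_normed_vector) \<Rightarrow> ('a \<times> 'a) set" where
  "generator T = {(x, y). ((\<lambda>t. (T t x - x) /\<^sub>R t) \<longlongrightarrow> y) (at_right 0)}"

text \<open>
  Analyticity of a semigroup on a real space is analyticity of its complexification. The
  complexification of \<^typ>\<open>'a\<close> is \<^typ>\<open>'a \<times> 'a\<close>, the pair \<open>(x, y)\<close> standing for \<open>x + iy\<close>, with
  the following multiplication by complex scalars.
\<close>

definition cplx_scale :: "complex \<Rightarrow> 'a \<times> 'a \<Rightarrow> 'a \<times> 'a::real_vector" where
  "cplx_scale z p = (Re z *\<^sub>R fst p - Im z *\<^sub>R snd p, Re z *\<^sub>R snd p + Im z *\<^sub>R fst p)"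

definition sector :: "real \<Rightarrow> complex set" where
  "sector \<theta> = {z. z \<noteq> 0 \<and> \<bar>Arg z\<bar> < \<theta>}"

text \<open>Complex differentiability in \<open>z\<close> is Frechet differentiability with a derivative of the form
  \<open>h \<mapsto> h d\<close>.\<close>

definition analytic_semigroup :: "(real \<Rightarrow> 'a \<Rightarrow> 'a::real_normed_vector) \<Rightarrow> bool" where
  "analytic_semigroup T \<longleftrightarrow> C0_semigroup T \<and>
     (\<exists>\<theta> S. 0 < \<theta> \<and> \<theta> \<le> pi / 2 \<and>
        (\<forall>t\<ge>0. \<forall>x y. S (complex_of_real t) (x, y) = (T t x, T t y)) \<and>
        (\<forall>z\<in>sector \<theta>. bounded_linear (S z) \<and> (\<forall>c p. S z (cplx_scale c p) = cplx_scale c (S z p))) \<and>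
        (\<forall>z\<in>sector \<theta>. \<forall>w\<in>sector \<theta>. S (z + w) = S z \<circ> S w) \<and>
        (\<forall>p. \<forall>z\<in>sector \<theta>. \<exists>d. ((\<lambda>z. S z p) has_derivative (\<lambda>h. cplx_scale h d)) (at z)) \<and>
        (\<forall>p. ((\<lambda>z. S z p) \<longlongrightarrow> p) (at 0 within sector \<theta>)))"

definition exp_stable :: "(real \<Rightarrow> 'a \<Rightarrow> 'a::real_normed_vector) \<Rightarrow> bool" where
  "exp_stable T \<longleftrightarrow> (\<exists>M>0. \<exists>\<omega>>0. \<forall>t\<ge>0. \<forall>x. norm (T t x) \<le> M * exp (- \<omega> * t) * norm x)"


section \<open>The shell model\<close>

text \<open>The coordinate formulas are stated for arbitrary sequences, i.e. without requiring that
  the result lie in \<open>H\<close>.\<close>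

definition sabra_A :: "(nat \<Rightarrow> real) \<Rightarrow> (nat \<Rightarrow> complex) \<Rightarrow> nat \<Rightarrow> complex" where
  "sabra_A k u n = of_real ((k n)\<^sup>2) * u n"

definition dom_A :: "(nat \<Rightarrow> real) \<Rightarrow> ell2 set" where
  "dom_A k = {u. sabra_A k (ell2_seq u) \<in> l2_seqs}"

definition sabra_B ::
  "(nat \<Rightarrow> real) \<Rightarrow> real \<Rightarrow> real \<Rightarrow> (nat \<Rightarrow> complex) \<Rightarrow> (nat \<Rightarrow> complex) \<Rightarrow> nat \<Rightarrow> complex" where
  "sabra_B k a b u v n =
     (if n = 0 then 0 else
        - \<i> * (of_real (a * k (n + 1)) * v (n + 2) * cnj (u (n + 1))
             + of_real (b * k n) * v (n + 1) * cnj (u (n - 1))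
             + of_real (a * k (n - 1)) * u (n - 1) * v (n - 2)
             + of_real (b * k (n - 1)) * v (n - 1) * u (n - 2)))"

definition stationary_solution ::
  "(nat \<Rightarrow> real) \<Rightarrow> real \<Rightarrow> real \<Rightarrow> real \<Rightarrow> ell2 \<Rightarrow> ell2 \<Rightarrow> bool" where
  "stationary_solution k a b \<nu> f ue \<longleftrightarrow> ue \<in> dom_A k \<and>
     (\<forall>n. of_real \<nu> * sabra_A k (ell2_seq ue) n + sabra_B k a b (ell2_seq ue) (ell2_seq ue) n
          = ell2_seq f n)"

definition lin_coord ::
  "(nat \<Rightarrow> real) \<Rightarrow> real \<Rightarrow> real \<Rightarrow> real \<Rightarrow> ell2 \<Rightarrow> (nat \<Rightarrow> complex) \<Rightarrow> nat \<Rightarrow> complex" where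
  "lin_coord k a b \<nu> ue u n = of_real \<nu> * sabra_A k u n
     + sabra_B k a b u (ell2_seq ue) n + sabra_B k a b (ell2_seq ue) u n"

definition lin_op ::
  "(nat \<Rightarrow> real) \<Rightarrow> real \<Rightarrow> real \<Rightarrow> real \<Rightarrow> ell2 \<Rightarrow> (ell2 \<times> ell2) set" where
  "lin_op k a b \<nu> ue = {(u, y). u \<in> dom_A k \<and>
     (\<forall>n. ell2_seq y n = lin_coord k a b \<nu> ue (ell2_seq u) n)}"

text \<open>The domain of the closed loop operator consists of all \<open>u \<in> H\<close> for which the sequence
  \<open>\<A>u + B\<^sub>1B\<^sub>1\<^sup>*\<R>u\<close> belongs to \<open>H\<close>, where \<open>\<A>u\<close> is given by its coordinate formula.\<close>

definition closed_loop_op ::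
  "(nat \<Rightarrow> real) \<Rightarrow> real \<Rightarrow> real \<Rightarrow> real \<Rightarrow> ell2 \<Rightarrow> (ell2 \<Rightarrow> ell2) \<Rightarrow> (ell2 \<Rightarrow> ell2) \<Rightarrow> (ell2 \<times> ell2) set"
  where
  "closed_loop_op k a b \<nu> ue B1 R = {(u, y).
     \<forall>n. ell2_seq y n = lin_coord k a b \<nu> ue (ell2_seq u) n + ell2_seq (B1 (adjoint B1 (R u))) n}"


section \<open>The differential game\<close>

text \<open>Elements of \<open>L\<^sup>2(0,\<infinity>;H)\<close> are represented by Borel functions on \<^typ>\<open>real\<close>, whose values
  outside \<open>(0,\<infinity>)\<close> are irrelevant; equality in \<open>L\<^sup>2\<close> is equality almost everywhere.\<close>

definition L2_pos :: "(real \<Rightarrow> ell2) set" where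
  "L2_pos = {w. set_borel_measurable lborel {0<..} w \<and>
                set_integrable lborel {0<..} (\<lambda>t. (norm (w t))\<^sup>2)}"

definition L2_eq :: "(real \<Rightarrow> ell2) \<Rightarrow> (real \<Rightarrow> ell2) \<Rightarrow> bool" where
  "L2_eq v w \<longleftrightarrow> (AE t in lborel. 0 < t \<longrightarrow> v t = w t)"

text \<open>Mild solution of \<open>du/dt + \<A>u = B\<^sub>1U + B\<^sub>2w\<close>, \<open>u(0) = u\<^sup>0\<close>, where \<open>T\<close> is the semigroup
  generated by \<open>-\<A>\<close>.\<close>

definition state ::
  "(real \<Rightarrow> ell2 \<Rightarrow> ell2) \<Rightarrow> (ell2 \<Rightarrow> ell2) \<Rightarrow> (ell2 \<Rightarrow> ell2) \<Rightarrow>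
   ell2 \<Rightarrow> (real \<Rightarrow> ell2) \<Rightarrow> (real \<Rightarrow> ell2) \<Rightarrow> real \<Rightarrow> ell2" where
  "state T B1 B2 u0 U w t =
     T t u0 + (LINT s:{0..t}|lborel. T (t - s) (B1 (U s) + B2 (w s)))"

text \<open>The cost is \<open>+\<infinity>\<close> if the state is not square integrable.\<close>

definition cost ::
  "real \<Rightarrow> (real \<Rightarrow> ell2) \<Rightarrow> (real \<Rightarrow> ell2) \<Rightarrow> (real \<Rightarrow> ell2) \<Rightarrow> ereal" where
  "cost \<gamma> u U w =
     ereal (1 / 2) * enn2ereal (\<integral>\<^sup>+t\<in>{0<..}. ennreal ((norm (u t))\<^sup>2) \<partial>lborel)
     + ereal (1 / 2 * (LINT t:{0<..}|lborel. (norm (U t))\<^sup>2)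
              - \<gamma> / 2 * (LINT t:{0<..}|lborel. (norm (w t))\<^sup>2))"

definition lower_value ::
  "(real \<Rightarrow> ell2 \<Rightarrow> ell2) \<Rightarrow> (ell2 \<Rightarrow> ell2) \<Rightarrow> (ell2 \<Rightarrow> ell2) \<Rightarrow> real \<Rightarrow>
   ell2 \<Rightarrow> (real \<Rightarrow> ell2) \<Rightarrow> ereal" where
  "lower_value T B1 B2 \<gamma> u0 w = (INF U\<in>L2_pos. cost \<gamma> (state T B1 B2 u0 U w) U w)"

definition game_value ::
  "(real \<Rightarrow> ell2 \<Rightarrow> ell2) \<Rightarrow> (ell2 \<Rightarrow> ell2) \<Rightarrow> (ell2 \<Rightarrow> ell2) \<Rightarrow> real \<Rightarrow> ell2 \<Rightarrow> ereal" where
  "game_value T B1 B2 \<gamma> u0 = (SUP w\<in>L2_pos. lower_value T B1 B2 \<gamma> u0 w)"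

definition worst_disturbance ::
  "(real \<Rightarrow> ell2 \<Rightarrow> ell2) \<Rightarrow> (ell2 \<Rightarrow> ell2) \<Rightarrow> (ell2 \<Rightarrow> ell2) \<Rightarrow> real \<Rightarrow>
   ell2 \<Rightarrow> (real \<Rightarrow> ell2) \<Rightarrow> bool" where
  "worst_disturbance T B1 B2 \<gamma> u0 w \<longleftrightarrow> w \<in> L2_pos \<and>
     lower_value T B1 B2 \<gamma> u0 w = game_value T B1 B2 \<gamma> u0"

definition optimal_control ::
  "(real \<Rightarrow> ell2 \<Rightarrow> ell2) \<Rightarrow> (ell2 \<Rightarrow> ell2) \<Rightarrow> (ell2 \<Rightarrow> ell2) \<Rightarrow> real \<Rightarrow>
   ell2 \<Rightarrow> (real \<Rightarrow> ell2) \<Rightarrow> (real \<Rightarrow> ell2) \<Rightarrow> bool" where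
  "optimal_control T B1 B2 \<gamma> u0 w U \<longleftrightarrow> U \<in> L2_pos \<and>
     cost \<gamma> (state T B1 B2 u0 U w) U w = lower_value T B1 B2 \<gamma> u0 w"

definition game_threshold ::
  "(real \<Rightarrow> ell2 \<Rightarrow> ell2) \<Rightarrow> (ell2 \<Rightarrow> ell2) \<Rightarrow> (ell2 \<Rightarrow> ell2) \<Rightarrow> real \<Rightarrow> bool" where
  "game_threshold T B1 B2 \<gamma>0 \<longleftrightarrow> 0 < \<gamma>0 \<and>
     (\<forall>\<gamma> u0. \<gamma> > \<gamma>0 \<longrightarrow> game_value T B1 B2 \<gamma> u0 < \<infinity> \<and>
        (\<exists>w. worst_disturbance T B1 B2 \<gamma> u0 w \<and>
             (\<forall>w'. worst_disturbance T B1 B2 \<gamma> u0 w' \<longrightarrow> L2_eq w' w))) \<and>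
     (\<forall>\<gamma> u0. 0 < \<gamma> \<and> \<gamma> < \<gamma>0 \<longrightarrow> game_value T B1 B2 \<gamma> u0 = \<infinity>)"

text \<open>Mild form of \<open>-dr/dt + \<A>\<^sup>*r = u\<close>, \<open>r(\<infinity>) = 0\<close>. As \<open>\<A>\<close> need not be stable, the variation of
  constants formula is imposed on finite intervals, and it need not determine \<open>r\<close> uniquely.\<close>

definition adjoint_solution ::
  "(real \<Rightarrow> ell2 \<Rightarrow> ell2) \<Rightarrow> (real \<Rightarrow> ell2) \<Rightarrow> (real \<Rightarrow> ell2) \<Rightarrow> bool" where
  "adjoint_solution T u r \<longleftrightarrow>
     (\<forall>t \<tau>. 0 \<le> t \<and> t \<le> \<tau> \<longrightarrow>
        r t = adjoint (T (\<tau> - t)) (r \<tau>) + (LINT s:{t..\<tau>}|lborel. adjoint (T (s - t)) (u s))) \<and>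
     (r \<longlongrightarrow> 0) at_top"

text \<open>\<open>\<R>u\<^sup>0 = r(0)\<close> with \<open>r\<close> an adjoint state of the optimal trajectory, and
  \<open>P(u\<^sup>0) = 1/2 (u\<^sup>0,\<R>u\<^sup>0)\<close>. The adjoint equation alone may leave some freedom in \<open>r\<close> when \<open>\<A>\<close> is
  unstable; the last two clauses, which say that \<open>\<R>\<close> is symmetric and represents the quadratic
  form \<open>2P\<close>, determine \<open>\<R>\<close> uniquely.\<close>

definition value_operator ::
  "(real \<Rightarrow> ell2 \<Rightarrow> ell2) \<Rightarrow> (ell2 \<Rightarrow> ell2) \<Rightarrow> (ell2 \<Rightarrow> ell2) \<Rightarrow> real \<Rightarrow> (ell2 \<Rightarrow> ell2) \<Rightarrow> bool" where
  "value_operator T B1 B2 \<gamma> R \<longleftrightarrow> bounded_linear R \<and>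
     (\<forall>u0. \<exists>w U r. worst_disturbance T B1 B2 \<gamma> u0 w \<and> optimal_control T B1 B2 \<gamma> u0 w U \<and>
        adjoint_solution T (state T B1 B2 u0 U w) r \<and> R u0 = r 0) \<and>
     (\<forall>u0. game_value T B1 B2 \<gamma> u0 = ereal (1 / 2 * inner u0 (R u0))) \<and>
     (\<forall>u v. inner (R u) v = inner u (R v))"

text \<open>On the domain of \<open>\<A>\<close>; this includes that \<open>\<R>\<close> maps the domain of \<open>\<A>\<close> into that of \<open>\<A>\<^sup>*\<close>.\<close>

definition riccati ::
  "(ell2 \<times> ell2) set \<Rightarrow> (ell2 \<Rightarrow> ell2) \<Rightarrow> (ell2 \<Rightarrow> ell2) \<Rightarrow> real \<Rightarrow> (ell2 \<Rightarrow> ell2) \<Rightarrow> bool" where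
  "riccati G B1 B2 \<gamma> R \<longleftrightarrow>
     (\<forall>(u, y)\<in>G. \<exists>z. (R u, z) \<in> op_adjoint G \<and>
        z + R y + R (B1 (adjoint B1 (R u)))
          - (1 / \<gamma>) *\<^sub>R R (B2 (adjoint B2 (R u))) - u = 0)"

end

theory Submission
  imports Defs "HOL-Complex_Analysis.Conformal_Mappings"
begin

text \<open>
  The closed loop operator is \<open>\<A>\<close> plus the bounded operator \<open>K = B\<^sub>1B\<^sub>1\<^sup>*\<R>\<close>, and both halves of the claim
  follow from this.

  \<^item> \<^bold>\<open>Analyticity.\<close> Adding a bounded operator to the generator of an analytic semigroup gives
    the generator of an analytic semigroup (\<open>analytic_semigroup_bounded_perturbation\<close>). The new
    semigroup is the sum of the Dyson series \<open>S\<^sub>0(z) = V(z)\<close>,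
    \<open>S\<^sub>j\<^sub>+\<^sub>1(z) = \<integral>\<^sub>0\<^sup>1 z V(z(1-s)) K S\<^sub>j(zs) ds\<close> along the segment from \<open>0\<close> to \<open>z\<close>. Every term is
    holomorphic in the sector of \<open>V\<close>, the series converges locally uniformly, and its sum solves
    Duhamel's equation. Uniqueness for that equation gives the semigroup law on the positive half
    line, and the identity theorem carries it to the whole sector.
  \<^item> \<^bold>\<open>Domain.\<close> As \<open>u\<^sub>e \<in> D(A)\<close>, the sequence \<open>k\<^sub>n u\<^sub>e\<^sub>,\<^sub>n\<close> is bounded, so that
    \<open>u \<mapsto> B(u,u\<^sub>e) + B(u\<^sub>e,u)\<close> maps \<open>H\<close> into \<open>H\<close>. Hence the maximal domain of the
    closed loop operator is \<open>D(A)\<close> (\<open>closed_loop_op_eq\<close>).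
  \<^item> \<^bold>\<open>Stability.\<close> Along \<open>u' = - \<A>u - Ku\<close> the Riccati equation gives
    \<open>d/dt (u,\<R>u) = - |u|\<^sup>2 - |B\<^sub>1\<^sup>*\<R>u|\<^sup>2 - \<gamma>\<^sup>-\<^sup>1|B\<^sub>2\<^sup>*\<R>u|\<^sup>2 \<le> - |u|\<^sup>2\<close>.
    So \<open>(u,\<R>u)\<close>, which is at most a multiple of \<open>|u|\<^sup>2\<close>, decays exponentially. It need not
    dominate \<open>|u|\<^sup>2\<close>, but its decrease over a unit time interval does, because the semigroup is
    bounded on bounded time intervals (\<open>lyapunov_exp_stable\<close>).

  Complex structures occur on two levels: \<open>H\<close> consists of complex sequences, but the operators are
  only real linear, so that holomorphy refers to the complexification \<open>H \<times> H\<close> with the scalar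
  multiplication \<^const>\<open>cplx_scale\<close>.
\<close>

section \<open>Vector-valued holomorphic functions\<close>

lemma cplx_scale_add_right: "cplx_scale z (p + q) = cplx_scale z p + cplx_scale z q"
  by (simp add: cplx_scale_def algebra_simps)

lemma cplx_scale_diff_right: "cplx_scale z (p - q) = cplx_scale z p - cplx_scale z q"
  by (simp add: cplx_scale_def algebra_simps)

lemma cplx_scale_add_left: "cplx_scale (z + w) p = cplx_scale z p + cplx_scale w p"
  by (simp add: cplx_scale_def algebra_simps)

lemma cplx_scale_scale [simp]: "cplx_scale z (cplx_scale w p) = cplx_scale (z * w) p"
  by (simp add: cplx_scale_def algebra_simps)

lemma cplx_scale_zero_right [simp]: "cplx_scale z 0 = 0"
  by (simp add: cplx_scale_def prod_eq_iff)

lemma cplx_scale_of_real [simp]: "cplx_scale (of_real r) p = r *\<^sub>R p"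
  by (simp add: cplx_scale_def prod_eq_iff)

lemma cplx_scale_zero_left [simp]: "cplx_scale 0 p = 0"
  using cplx_scale_of_real[of 0 p] by simp

lemma cplx_scale_one [simp]: "cplx_scale 1 p = p"
  using cplx_scale_of_real[of 1 p] by simp

lemma cplx_scale_scaleR: "cplx_scale z (r *\<^sub>R p) = r *\<^sub>R cplx_scale z p"
  by (simp add: cplx_scale_def algebra_simps)

lemma norm_cplx_scale [simp]:
  fixes p :: "'a::real_inner \<times> 'a"
  shows "norm (cplx_scale z p) = cmod z * norm p"
proof -
  have "(norm (cplx_scale z p))\<^sup>2 = ((Re z)\<^sup>2 + (Im z)\<^sup>2) * (norm p)\<^sup>2"
    unfolding power2_norm_eq_inner cplx_scale_def
    by (simp add: inner_prod_def inner_add inner_diff algebra_simps power2_eq_square inner_commute)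
  also have "\<dots> = (cmod z * norm p)\<^sup>2"
    by (simp add: cmod_power2 power_mult_distrib)
  finally show ?thesis by (rule power2_eq_imp_eq) auto
qed

lemma bounded_linear_cplx_scale:
  "bounded_linear (cplx_scale z :: 'a::real_inner \<times> 'a \<Rightarrow> _)"
  by (rule bounded_linear_intro[where K = "cmod z"])
     (auto simp: cplx_scale_add_right cplx_scale_scaleR mult.commute)

lemma bounded_bilinear_cplx_scale:
  "bounded_bilinear (cplx_scale :: complex \<Rightarrow> 'a::real_inner \<times> 'a \<Rightarrow> _)"
proof
  show "\<exists>K. \<forall>z (p::'a \<times> 'a). norm (cplx_scale z p) \<le> norm z * norm p * K"
    by (intro exI[of _ 1]) simp
qed (auto simp: cplx_scale_add_right cplx_scale_add_left cplx_scale_scaleR cplx_scale_def[of "_ *\<^sub>R _"]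
      cplx_scale_def[of _ "(_, _)"] scaleR_diff_right scaleR_add_right)

lemmas continuous_on_cplx_scale = bounded_bilinear.continuous_on[OF bounded_bilinear_cplx_scale]

text \<open>The complex linear functional whose real part is \<open>inner p q\<close>. These functionals reduce
  statements about holomorphic functions with values in \<open>'a \<times> 'a\<close> to scalar ones.\<close>

definition cplx_functional :: "'a::real_inner \<times> 'a \<Rightarrow> 'a \<times> 'a \<Rightarrow> complex" where
  "cplx_functional q p = Complex (inner p q) (- inner (cplx_scale \<i> p) q)"

lemma cplx_functional_scale:
  "cplx_functional q (cplx_scale z p) = z * cplx_functional q p"
  by (simp add: cplx_functional_def cplx_scale_def complex_eq_iff inner_prod_def
      inner_diff inner_add algebra_simps)

lemma norm_cplx_functional_le: "cmod (cplx_functional q p) \<le> 2 * norm p * norm q"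
proof -
  have "cmod (cplx_functional q p) \<le> \<bar>inner p q\<bar> + \<bar>inner (cplx_scale \<i> p) q\<bar>"
    using cmod_le[of "cplx_functional q p"] by (simp add: cplx_functional_def)
  also have "\<dots> \<le> norm p * norm q + norm (cplx_scale \<i> p) * norm q"
    by (intro add_mono Cauchy_Schwarz_ineq2)
  finally show ?thesis by simp
qed

lemma bounded_linear_cplx_functional: "bounded_linear (cplx_functional q)"
proof (rule bounded_linear_intro[where K = "2 * norm q"])
  show "norm (cplx_functional q x) \<le> norm x * (2 * norm q)" for x
    using norm_cplx_functional_le[of q x] by (simp add: mult_ac)
qed (auto simp: cplx_functional_def complex_eq_iff cplx_scale_add_right cplx_scale_scaleR inner_add)

text \<open>The functionals of norm at most \<open>2\<close> detect the norm, so that estimates which hold uniformly for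
  them hold in norm.\<close>

lemma norm_le_cplx_functional_sgn: "norm p \<le> cmod (cplx_functional (sgn p) p)"
proof -
  have "norm p = Re (cplx_functional (sgn p) p)"
    by (cases "p = 0")
       (auto simp: cplx_functional_def sgn_div_norm power2_norm_eq_inner[symmetric] power2_eq_square)
  also have "\<dots> \<le> cmod (cplx_functional (sgn p) p)" by (rule complex_Re_le_cmod)
  finally show ?thesis .
qed

lemma cplx_functional_eqI:
  assumes "\<And>q. cplx_functional q p = cplx_functional q p'"
  shows "p = p'"
proof -
  have "cplx_functional q (p - p') = 0" for q
    using assms by (simp add: linear_diff[OF bounded_linear.linear[OF bounded_linear_cplx_functional]])
  from norm_le_cplx_functional_sgn[of "p - p'", unfolded this] show ?thesis by simp
qed

text \<open>The difference quotient form of complex differentiability. For products it is handier than the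
  equivalent Frechet form, because an operator that commutes with \<^const>\<open>cplx_scale\<close> can be
  moved into the quotient.\<close>

definition has_cplx_deriv ::
  "(complex \<Rightarrow> 'a::real_inner \<times> 'a) \<Rightarrow> 'a \<times> 'a \<Rightarrow> complex \<Rightarrow> bool" where
  "has_cplx_deriv f d z \<longleftrightarrow> ((\<lambda>h. cplx_scale (inverse h) (f (z + h) - f z)) \<longlongrightarrow> d) (at 0)"

lemma has_cplx_deriv_iff:
  "has_cplx_deriv f d z \<longleftrightarrow> (f has_derivative (\<lambda>h. cplx_scale h d)) (at z)"
proof -
  have bl: "bounded_linear (\<lambda>h. cplx_scale h d)"
    by (rule bounded_bilinear.bounded_linear_left[OF bounded_bilinear_cplx_scale])
  have eq: "norm (cplx_scale (inverse h) (f (z + h) - f z) - d)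
      = norm (f (z + h) - f z - cplx_scale h d) / norm h" if "h \<noteq> 0" for h
  proof -
    have "cplx_scale (inverse h) (f (z + h) - f z) - d
        = cplx_scale (inverse h) (f (z + h) - f z - cplx_scale h d)"
      using that by (simp add: cplx_scale_diff_right)
    then show ?thesis by (simp add: norm_inverse divide_inverse mult.commute)
  qed
  have "has_cplx_deriv f d z \<longleftrightarrow>
      ((\<lambda>h. norm (cplx_scale (inverse h) (f (z + h) - f z) - d)) \<longlongrightarrow> 0) (at 0)"
    unfolding has_cplx_deriv_def by (subst LIM_zero_iff[symmetric]) (simp add: tendsto_norm_zero_iff)
  also have "\<dots> \<longleftrightarrow> ((\<lambda>h. norm (f (z + h) - f z - cplx_scale h d) / norm h) \<longlongrightarrow> 0) (at 0)"
    by (rule filterlim_cong) (auto simp: eventually_at_filter eq)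
  also have "\<dots> \<longleftrightarrow> (f has_derivative (\<lambda>h. cplx_scale h d)) (at z)"
    using bl by (simp add: has_derivative_at)
  finally show ?thesis .
qed

lemma has_cplx_deriv_functional:
  assumes "has_cplx_deriv f d z"
  shows "((\<lambda>z. cplx_functional q (f z)) has_field_derivative cplx_functional q d) (at z)"
proof -
  have "((\<lambda>h. cplx_functional q (cplx_scale (inverse h) (f (z + h) - f z)))
      \<longlongrightarrow> cplx_functional q d) (at 0)"
    using assms bounded_linear.tendsto[OF bounded_linear_cplx_functional]
    unfolding has_cplx_deriv_def by blast
  then show ?thesis
    unfolding DERIV_def cplx_functional_scale
      linear_diff[OF bounded_linear.linear[OF bounded_linear_cplx_functional]]
    by (simp add: divide_inverse mult.commute)
qed

text \<open>Taylor's theorem, with the second derivative on the disc of half the radius controlled by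
  Cauchy's inequality. Only the bound on \<open>g\<close> itself enters the constant.\<close>

lemma holomorphic_second_order:
  assumes g: "g holomorphic_on U" and U: "open U" "cball z r \<subseteq> U" and r: "0 < r"
    and B: "\<And>w. w \<in> cball z r \<Longrightarrow> cmod (g w) \<le> B"
    and h: "cmod h \<le> r / 2"
  shows "cmod (g (z + h) - g z - h * deriv g z) \<le> 8 * B / r\<^sup>2 * (cmod h)\<^sup>2"
proof -
  define f where "f i = (deriv ^^ i) g" for i
  have hol: "f i holomorphic_on U" for i
    unfolding f_def by (rule holomorphic_higher_deriv[OF g U(1)])
  have sub: "cball z (r / 2) \<subseteq> U" using U(2) r by auto
  have der: "(f i has_field_derivative f (Suc i) w) (at w within cball z (r/2))"
    if "w \<in> cball z (r / 2)" for i w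
  proof -
    have "(f i has_field_derivative deriv (f i) w) (at w)"
      using holomorphic_derivI[OF hol U(1)] that sub by blast
    then show ?thesis by (simp add: f_def has_field_derivative_at_within)
  qed
  have bd: "cmod (f (Suc 1) w) \<le> 8 * B / r\<^sup>2" if w: "w \<in> cball z (r / 2)" for w
  proof -
    have "w' \<in> cball z r" if "w' \<in> cball w (r / 2)" for w'
      using w that dist_triangle[of z w' w] by (simp add: dist_commute)
    then have cb: "cball w (r / 2) \<subseteq> cball z r" by blast
    have "cmod ((deriv ^^ 2) g w) \<le> fact 2 * B / (r / 2) ^ 2"
    proof (rule Cauchy_inequality)
      show "g holomorphic_on ball w (r / 2)"
        by (rule holomorphic_on_subset[OF g]) (use cb U(2) ball_subset_cball in blast)
      show "continuous_on (cball w (r / 2)) g"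
        by (rule continuous_on_subset[OF holomorphic_on_imp_continuous_on[OF g]]) (use cb U(2) in blast)
      show "cmod (g x) \<le> B" if "cmod (w - x) = r / 2" for x
        using B cb that by (auto simp: dist_norm)
    qed (use r in auto)
    then show ?thesis by (simp add: f_def power_divide numeral_2_eq_2 mult_ac)
  qed
  have "cmod (f 0 (z + h) - (\<Sum>i\<le>1. f i z * ((z + h) - z) ^ i / fact i))
      \<le> 8 * B / r\<^sup>2 * cmod ((z + h) - z) ^ Suc 1 / fact 1"
  proof (rule complex_Taylor)
    show "(f i has_field_derivative f (Suc i) x) (at x within cball z (r/2))"
      if "x \<in> cball z (r/2)" "i \<le> 1" for i x using der[OF that(1)] .
    show "cmod (f (Suc 1) x) \<le> 8 * B / r\<^sup>2" if "x \<in> cball z (r/2)" for x using bd[OF that] .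
  qed (use h r in \<open>auto simp: dist_norm\<close>)
  then show ?thesis by (simp add: f_def power2_eq_square algebra_simps)
qed

text \<open>The remainder of the first order expansion is controlled by a bound on the function alone. This
  uniformity is what allows limits to be differentiated: below, sums and integrals of
  holomorphic functions are differentiated by summing or integrating these estimates.\<close>

lemma has_cplx_deriv_second_order:
  assumes f: "\<And>w. w \<in> U \<Longrightarrow> \<exists>d. has_cplx_deriv f d w" and U: "open U" "cball z r \<subseteq> U" and r: "0 < r"
    and B: "\<And>w. w \<in> cball z r \<Longrightarrow> norm (f w) \<le> B"
    and d: "has_cplx_deriv f d z"
  shows "norm d \<le> 2 * B / r"
    and "cmod h \<le> r / 2 \<Longrightarrow> norm (f (z + h) - f z - cplx_scale h d) \<le> 16 * B / r\<^sup>2 * (cmod h)\<^sup>2"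
proof -
  have "0 \<le> norm (f z)" by simp
  also have "\<dots> \<le> B" using B[of z] r by simp
  finally have B0: "0 \<le> B" .
  have hol: "(\<lambda>w. cplx_functional q (f w)) holomorphic_on U" for q
    using f has_cplx_deriv_functional U(1) by (subst holomorphic_on_open) blast+
  have dq: "deriv (\<lambda>w. cplx_functional q (f w)) z = cplx_functional q d" for q
    by (rule DERIV_imp_deriv[OF has_cplx_deriv_functional[OF d]])
  have Bq: "cmod (cplx_functional q (f w)) \<le> 2 * B" if "norm q \<le> 1" "w \<in> cball z r" for q w
  proof -
    have "norm (f w) * norm q \<le> B * 1" using B that B0 by (intro mult_mono) auto
    then show ?thesis using norm_cplx_functional_le[of q "f w"] by simp
  qed
  have sgn1: "norm (sgn p) \<le> 1" for p :: "'a \<times> 'a" by (simp add: norm_sgn)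
  show "norm d \<le> 2 * B / r"
  proof -
    let ?g = "\<lambda>w. cplx_functional (sgn d) (f w)"
    have "cmod ((deriv ^^ 1) ?g z) \<le> fact 1 * (2 * B) / r ^ 1"
    proof (rule Cauchy_inequality)
      show "?g holomorphic_on ball z r"
        by (rule holomorphic_on_subset[OF hol]) (use U(2) ball_subset_cball in blast)
      show "continuous_on (cball z r) ?g"
        by (rule continuous_on_subset[OF holomorphic_on_imp_continuous_on[OF hol] U(2)])
      show "cmod (?g x) \<le> 2 * B" if "cmod (z - x) = r" for x
        using Bq[OF sgn1] that by (auto simp: dist_norm)
    qed (use r in auto)
    then show ?thesis using norm_le_cplx_functional_sgn[of d] by (simp add: dq)
  qed
  show "norm (f (z + h) - f z - cplx_scale h d) \<le> 16 * B / r\<^sup>2 * (cmod h)\<^sup>2" if h: "cmod h \<le> r / 2"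
  proof -
    let ?p = "f (z + h) - f z - cplx_scale h d"
    have "norm ?p \<le> cmod (cplx_functional (sgn ?p) ?p)" by (rule norm_le_cplx_functional_sgn)
    also have "\<dots> \<le> 8 * (2 * B) / r\<^sup>2 * (cmod h)\<^sup>2"
      using holomorphic_second_order[OF hol U r Bq[OF sgn1] h, of ?p]
      unfolding dq by (simp add: cplx_functional_scale
          linear_diff[OF bounded_linear.linear[OF bounded_linear_cplx_functional]])
    finally show ?thesis by simp
  qed
qed

lemma has_cplx_derivI:
  assumes r: "0 < r"
    and est: "\<And>h. cmod h \<le> r \<Longrightarrow> norm (f (z + h) - f z - cplx_scale h d) \<le> c * (cmod h)\<^sup>2"
  shows "has_cplx_deriv f d z"
  unfolding has_cplx_deriv_def
proof (rule LIM_zero_cancel, rule tendsto_norm_zero_cancel, rule tendsto_sandwich)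
  show "\<forall>\<^sub>F h in at 0. 0 \<le> norm (cplx_scale (inverse h) (f (z + h) - f z) - d)" by simp
  show "((\<lambda>h. c * cmod h) \<longlongrightarrow> 0) (at 0)"
    by (intro tendsto_mult_right_zero tendsto_norm_zero tendsto_ident_at)
  have "norm (cplx_scale (inverse h) (f (z + h) - f z) - d) \<le> c * cmod h"
    if "h \<noteq> 0" "cmod h < r" for h
  proof -
    have "cplx_scale (inverse h) (f (z + h) - f z) - d
        = cplx_scale (inverse h) (f (z + h) - f z - cplx_scale h d)"
      using that by (simp add: cplx_scale_diff_right)
    also have "norm \<dots> \<le> inverse (cmod h) * (c * (cmod h)\<^sup>2)"
      unfolding norm_cplx_scale norm_inverse using est[of h] that(2) by (intro mult_left_mono) auto
    also have "\<dots> = c * cmod h" using that(1) by (simp add: power2_eq_square field_simps)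
    finally show ?thesis .
  qed
  then show "\<forall>\<^sub>F h in at 0. norm (cplx_scale (inverse h) (f (z + h) - f z) - d) \<le> c * cmod h"
    using r by (auto simp: eventually_at intro!: exI[of _ r])
qed simp

section \<open>Uniform boundedness and adjoints\<close>

text \<open>By Baire's theorem one of the closed sets where all \<open>F n\<close> are bounded by \<open>m\<close> has interior points;
  a ball inside it, moved to the origin, gives the uniform bound.\<close>

lemma uniform_boundedness:
  fixes F :: "nat \<Rightarrow> 'a::banach \<Rightarrow> 'b::real_normed_vector"
  assumes F: "\<And>n. bounded_linear (F n)"
    and bd: "\<And>x. \<exists>c. \<forall>n. norm (F n x) \<le> c"
  shows "\<exists>M. \<forall>n x. norm (F n x) \<le> M * norm x"
proof -
  define A where "A m = {x. \<forall>n. norm (F n x) \<le> real m}" for m :: nat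
  have closed: "closed (A m)" for m
    unfolding A_def
    by (intro closed_Collect_all closed_Collect_le continuous_on_norm continuous_on_const
        linear_continuous_on F)
  have "x \<in> (\<Union>m. A m)" for x
  proof -
    obtain c where c: "\<And>n. norm (F n x) \<le> c" using bd by blast
    obtain m :: nat where "c \<le> real m" using real_arch_simple by blast
    with c have "x \<in> A m" unfolding A_def by (auto intro: order_trans)
    then show ?thesis by blast
  qed
  then have "\<Union>(range A) = UNIV" by blast
  then have "interior (\<Union>(range A)) \<noteq> {}" by simp
  moreover have "interior (\<Union>(range A)) = {}" if "\<And>m. interior (A m) = {}"
    using Baire_category_alt[of "euclidean :: 'a topology" "range A"] closed that
    by (auto simp: completely_metrizable_space_euclidean)
  ultimately obtain m where "interior (A m) \<noteq> {}" by blast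
  then obtain x0 where "x0 \<in> interior (A m)" by blast
  then obtain r where r: "0 < r" "cball x0 r \<subseteq> A m"
    by (meson mem_interior_cball)
  have "norm (F n x) \<le> 2 * real m / r * norm x" for n x
  proof (cases "x = 0")
    case True
    then show ?thesis using linear_simps(3)[OF F] by simp
  next
    case False
    define y where "y = (r / norm x) *\<^sub>R x"
    have "x0 + y \<in> A m" "x0 \<in> A m"
      using r False by (auto simp: y_def dist_norm intro!: subsetD[OF r(2)])
    then have "norm (F n (x0 + y)) \<le> real m" "norm (F n x0) \<le> real m"
      unfolding A_def by blast+
    moreover have "F n y = F n (x0 + y) - F n x0"
      using linear_simps(1)[OF F] by simp
    ultimately have "norm (F n y) \<le> 2 * real m"
      using norm_triangle_ineq4[of "F n (x0 + y)" "F n x0"] by simp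
    moreover have "norm (F n y) = r / norm x * norm (F n x)"
      using r unfolding y_def linear_simps(5)[OF F] by simp
    ultimately show ?thesis using r False by (simp add: field_simps)
  qed
  then show ?thesis by blast
qed

text \<open>The representing vector minimises \<open>Q x = inner x x - 2 * f x\<close>. A minimising sequence is Cauchy by the
  parallelogram law, and the first variation at the minimiser is the claim.\<close>

lemma bounded_linear_functional_representation:
  fixes f :: "'a::{real_inner, complete_space} \<Rightarrow> real"
  assumes f: "bounded_linear f"
  shows "\<exists>y. \<forall>x. f x = inner x y"
proof -
  interpret f: bounded_linear f by fact
  define Q where "Q x = inner x x - 2 * f x" for x
  obtain k where k: "\<And>x. norm (f x) \<le> norm x * k" using f.bounded by blast
  have lower: "- k\<^sup>2 \<le> Q x" for x
  proof -
    have "0 \<le> (norm x - k)\<^sup>2" by simp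
    then have "- k\<^sup>2 \<le> (norm x)\<^sup>2 - 2 * (norm x * k)" by (simp add: power2_diff mult_ac)
    also have "\<dots> \<le> Q x"
      using k[of x] by (simp add: Q_def power2_norm_eq_inner)
    finally show ?thesis .
  qed
  define m where "m = Inf (range Q)"
  have bdd: "bdd_below (range Q)" using lower by (auto intro!: bdd_belowI)
  have m: "m \<le> Q x" for x unfolding m_def by (rule cInf_lower) (use bdd in auto)
  have "\<exists>x. Q x < m + inverse (real (Suc n))" for n
    using cInf_lessD[of "range Q" "m + inverse (real (Suc n))"] by (force simp: m_def)
  then obtain X where X: "\<And>n. Q (X n) < m + inverse (real (Suc n))" by metis
  have par: "(norm (x - y))\<^sup>2 \<le> 2 * (Q x - m) + 2 * (Q y - m)" for x y
  proof -
    have "Q ((1/2) *\<^sub>R (x + y)) = (Q x + Q y) / 2 - (norm (x - y))\<^sup>2 / 4"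
      unfolding Q_def power2_norm_eq_inner f.scaleR f.add
      by (simp add: inner_add inner_diff inner_commute field_simps)
    with m[of "(1/2) *\<^sub>R (x + y)"] show ?thesis by argo
  qed
  have "Cauchy X"
  proof (rule CauchyI)
    fix e :: real assume e: "0 < e"
    obtain N where N: "inverse (real (Suc N)) < e\<^sup>2 / 4"
      using reals_Archimedean[of "e\<^sup>2 / 4"] e by auto
    have "norm (X a - X b) < e" if "N \<le> a" "N \<le> b" for a b
    proof -
      have "inverse (real (Suc a)) \<le> inverse (real (Suc N))" "inverse (real (Suc b)) \<le> inverse (real (Suc N))"
        using that by (auto intro!: le_imp_inverse_le)
      then have "(norm (X a - X b))\<^sup>2 < e\<^sup>2"
        using par[of "X a" "X b"] X[of a] X[of b] N by argo
      then show ?thesis using e by (simp add: power_less_imp_less_base)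
    qed
    then show "\<exists>M. \<forall>a\<ge>M. \<forall>b\<ge>M. norm (X a - X b) < e" by blast
  qed
  then obtain y where y: "X \<longlonglongrightarrow> y" using Cauchy_convergent_iff convergent_def by blast
  have "(\<lambda>n. Q (X n)) \<longlonglongrightarrow> Q y"
    unfolding Q_def by (intro tendsto_intros y f.tendsto)
  moreover have "(\<lambda>n. m + inverse (real (Suc n))) \<longlonglongrightarrow> m"
    using LIMSEQ_inverse_real_of_nat_add by simp
  ultimately have "Q y \<le> m"
    by (rule LIMSEQ_le) (use X less_imp_le in blast)
  then have min: "Q y \<le> Q x" for x using m[of x] by linarith
  have "f x = inner x y" for x
  proof (rule ccontr)
    define c where "c = inner x y - f x"
    assume "f x \<noteq> inner x y"
    then have c: "c \<noteq> 0" by (simp add: c_def)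
    have x: "0 < inner x x" using c f.zero by (auto simp: c_def)
    define t where "t = - c / inner x x"
    have "Q (y + t *\<^sub>R x) - Q y = 2 * t * c + t\<^sup>2 * inner x x"
      unfolding Q_def c_def f.add f.scaleR
      by (simp add: inner_add inner_commute algebra_simps power2_eq_square)
    also have "\<dots> = - c\<^sup>2 / inner x x"
      using x by (simp add: t_def power2_eq_square field_simps)
    also have "\<dots> < 0" using x c by simp
    finally show False using min[of "y + t *\<^sub>R x"] by simp
  qed
  then show ?thesis by blast
qed

text \<open>The library constant \<^const>\<open>adjoint\<close> is a choice of some adjoint. On a complete domain one exists by
  the representation of functionals.\<close>

lemma
  fixes f :: "'a::{real_inner, complete_space} \<Rightarrow> 'b::real_inner"
  assumes f: "bounded_linear f"
  shows inner_adjoint: "inner x (adjoint f y) = inner (f x) y"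
    and bounded_linear_adjoint: "bounded_linear (adjoint f)"
proof -
  have "\<exists>z. \<forall>x. inner (f x) y = inner x z" for y
    by (rule bounded_linear_functional_representation)
       (rule bounded_linear_compose[OF bounded_linear_inner_left f, unfolded o_def])
  then have "\<exists>g. \<forall>x y. inner (f x) y = inner x (g y)" by metis
  then have adj: "inner (f x) y = inner x (adjoint f y)" for x y
    unfolding adjoint_def by (rule someI2_ex) blast
  then show "inner x (adjoint f y) = inner (f x) y" by simp
  obtain k where k: "\<And>x. norm (f x) \<le> norm x * k" "0 < k"
    using bounded_linear.pos_bounded[OF f] by (auto simp: mult.commute)
  show "bounded_linear (adjoint f)"
  proof (rule bounded_linear_intro[where K = k])
    fix u v :: 'b and r :: real
    have ext: "a = b" if "\<And>x. inner x a = inner x b" for a b :: 'a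
    proof -
      have "inner (a - b) (a - b) = 0" unfolding inner_diff_right that by simp
      then show ?thesis by simp
    qed
    show "adjoint f (u + v) = adjoint f u + adjoint f v"
      by (rule ext) (simp add: inner_add_right flip: adj)
    show "adjoint f (r *\<^sub>R u) = r *\<^sub>R adjoint f u"
      by (rule ext) (simp flip: adj)
    have "norm (adjoint f u) * norm (adjoint f u) = inner (f (adjoint f u)) u"
      unfolding adj by (simp add: power2_norm_eq_inner flip: power2_eq_square)
    also have "\<dots> \<le> norm (f (adjoint f u)) * norm u" by (rule norm_cauchy_schwarz)
    also have "\<dots> \<le> (norm (adjoint f u) * k) * norm u" using k(1) by (intro mult_right_mono) auto
    finally show "norm (adjoint f u) \<le> norm u * k"
      using k(2) by (cases "norm (adjoint f u) = 0") (auto simp: mult_ac)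
  qed
qed

section \<open>Sectors and holomorphic limits\<close>

text \<open>With \<open>\<phi> = Arg z\<close> the two inequalities in \<open>cos \<theta> * \<bar>Im z\<bar> < sin \<theta> * Re z\<close> say that
  \<open>sin (\<theta> - \<phi>)\<close> and \<open>sin (\<theta> + \<phi>)\<close> are positive. In this form the sector is visibly an open convex
  cone.\<close>

lemma sector_iff:
  assumes "0 < \<theta>" "\<theta> \<le> pi / 2"
  shows "z \<in> sector \<theta> \<longleftrightarrow> 0 < Re z \<and> cos \<theta> * \<bar>Im z\<bar> < sin \<theta> * Re z"
proof (cases "0 < Re z")
  case False
  then have "z \<notin> sector \<theta>" using Arg_Re_pos[of z] assms by (auto simp: sector_def)
  with False show ?thesis by simp
next
  case True
  then have z: "z \<noteq> 0" by auto
  have arg: "\<bar>Arg z\<bar> < pi / 2" using True Arg_Re_pos by blast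
  have re: "Re z = cmod z * cos (Arg z)" and im: "Im z = cmod z * sin (Arg z)"
    using cis_Arg[OF z] z by (auto simp: complex_eq_iff sgn_eq field_simps)
  have pos: "0 < sin x \<longleftrightarrow> 0 < x" if "- pi < x" "x < pi" for x :: real
    using that sin_gt_zero[of x] sin_ge_zero[of "- x"] by force
  have "cos \<theta> * \<bar>Im z\<bar> < sin \<theta> * Re z \<longleftrightarrow>
      0 < sin \<theta> * Re z - cos \<theta> * Im z \<and> 0 < sin \<theta> * Re z + cos \<theta> * Im z"
  proof -
    have "cos \<theta> * \<bar>Im z\<bar> = \<bar>cos \<theta> * Im z\<bar>"
      using cos_ge_zero[of \<theta>] assms by (simp add: abs_mult)
    then show ?thesis by linarith
  qed
  also have "\<dots> \<longleftrightarrow> 0 < cmod z * sin (\<theta> - Arg z) \<and> 0 < cmod z * sin (\<theta> + Arg z)"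
    unfolding re im by (simp add: sin_diff sin_add algebra_simps)
  also have "\<dots> \<longleftrightarrow> \<bar>Arg z\<bar> < \<theta>"
    using z arg assms pos[of "\<theta> - Arg z"] pos[of "\<theta> + Arg z"]
    by (auto simp: zero_less_mult_iff abs_less_iff)
  finally show ?thesis using True z by (simp add: sector_def)
qed

context
  fixes \<theta> :: real
  assumes \<theta>: "0 < \<theta>" "\<theta> \<le> pi / 2"
begin

lemma open_sector: "open (sector \<theta>)"
proof -
  have "sector \<theta> = {z. 0 < Re z} \<inter> {z. cos \<theta> * \<bar>Im z\<bar> < sin \<theta> * Re z}"
    using sector_iff[OF \<theta>] by auto
  then show ?thesis
    by (auto intro!: open_Int open_Collect_less continuous_intros)
qed

lemma sector_add: "z \<in> sector \<theta> \<Longrightarrow> w \<in> sector \<theta> \<Longrightarrow> z + w \<in> sector \<theta>"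
proof -
  assume *: "z \<in> sector \<theta>" "w \<in> sector \<theta>"
  have "cos \<theta> * \<bar>Im (z + w)\<bar> \<le> cos \<theta> * \<bar>Im z\<bar> + cos \<theta> * \<bar>Im w\<bar>"
    using cos_ge_zero[of \<theta>] \<theta> by (auto simp flip: distrib_left intro!: mult_left_mono)
  then show ?thesis using * by (auto simp: sector_iff[OF \<theta>] distrib_left)
qed

lemma sector_scale: "z \<in> sector \<theta> \<Longrightarrow> 0 < r \<Longrightarrow> z * of_real r \<in> sector \<theta>"
  by (simp add: sector_def)

lemma sector_of_real: "0 < r \<Longrightarrow> of_real r \<in> sector \<theta>"
  using \<theta> by (simp add: sector_def)

lemma convex_sector: "convex (sector \<theta>)"
  unfolding convex_alt
proof (intro ballI allI impI)
  fix z w u assume *: "z \<in> sector \<theta>" "w \<in> sector \<theta>" "0 \<le> u \<and> u \<le> (1::real)"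
  then consider "u = 0" | "u = 1" | "0 < u" "u < 1" by linarith
  then show "(1 - u) *\<^sub>R z + u *\<^sub>R w \<in> sector \<theta>"
  proof cases
    case 3
    with * have "z * of_real (1 - u) + w * of_real u \<in> sector \<theta>"
      by (intro sector_add sector_scale) auto
    then show ?thesis by (simp add: scaleR_conv_of_real mult.commute)
  qed (use * in auto)
qed

lemma zero_notin_sector: "0 \<notin> sector \<theta>"
  by (simp add: sector_def)

end

lemma has_cplx_deriv_const: "has_cplx_deriv (\<lambda>z. p) 0 z"
  by (simp add: has_cplx_deriv_def)

lemma has_cplx_deriv_comp_scale:
  assumes "has_cplx_deriv f d (z * a)"
  shows "has_cplx_deriv (\<lambda>z. f (z * a)) (cplx_scale a d) z"
proof -
  have "((\<lambda>z. z * a) has_derivative (\<lambda>h. h * a)) (at z)"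
    by (auto intro!: derivative_eq_intros)
  from has_derivative_compose[OF this assms[unfolded has_cplx_deriv_iff]]
  show ?thesis by (simp add: has_cplx_deriv_iff)
qed

lemma has_cplx_deriv_shift:
  "has_cplx_deriv f d (z + a) \<Longrightarrow> has_cplx_deriv (\<lambda>z. f (z + a)) d z"
  by (simp add: has_cplx_deriv_def add_ac)

lemma has_cplx_deriv_scale:
  assumes "has_cplx_deriv f d z"
  shows "has_cplx_deriv (\<lambda>z. cplx_scale z (f z)) (cplx_scale z d + f z) z"
  using bounded_bilinear.FDERIV[OF bounded_bilinear_cplx_scale has_derivative_ident
      assms[unfolded has_cplx_deriv_iff]]
  by (simp add: has_cplx_deriv_iff cplx_scale_add_right mult.commute)

lemma has_cplx_deriv_linear:
  assumes L: "bounded_linear L" "\<And>c p. L (cplx_scale c p) = cplx_scale c (L p)"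
    and f: "has_cplx_deriv f d z"
  shows "has_cplx_deriv (\<lambda>z. L (f z)) (L d) z"
  using bounded_linear.has_derivative[OF L(1) f[unfolded has_cplx_deriv_iff]]
  by (simp add: has_cplx_deriv_iff L(2))

lemma has_cplx_deriv_isCont:
  assumes "has_cplx_deriv f d z" shows "isCont f z"
  using assms unfolding has_cplx_deriv_iff by (rule has_derivative_continuous)

text \<open>The derivative of the integral is the integral of the derivatives \<open>d s\<close>: the second order estimate holds with one
  constant for all \<open>s\<close>, so \<open>d\<close> is a uniform limit of continuous difference quotients, and the
  estimate may be integrated.\<close>

lemma has_cplx_deriv_integral:
  fixes g :: "complex \<Rightarrow> real \<Rightarrow> 'a::{real_inner, banach} \<times> 'a"
  assumes U: "open U" and cont: "continuous_on (U \<times> {0..1}) (\<lambda>(z, s). g z s)"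
    and der: "\<And>z s. z \<in> U \<Longrightarrow> s \<in> {0..1} \<Longrightarrow> \<exists>d. has_cplx_deriv (\<lambda>z. g z s) d z"
    and z: "z \<in> U"
  shows "\<exists>d. has_cplx_deriv (\<lambda>z. integral {0..1} (g z)) d z"
proof -
  obtain r where r: "0 < r" "cball z r \<subseteq> U" using U z open_contains_cball by blast
  have "compact ((\<lambda>(z, s). g z s) ` (cball z r \<times> {0..1}))"
    by (intro compact_continuous_image compact_Times compact_cball compact_Icc
        continuous_on_subset[OF cont]) (use r in auto)
  then have "bounded ((\<lambda>(z, s). g z s) ` (cball z r \<times> {0..1}))"
    by (rule compact_imp_bounded)
  then obtain B where B: "\<And>p. p \<in> (\<lambda>(z, s). g z s) ` (cball z r \<times> {0..1}) \<Longrightarrow> norm p \<le> B"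
    unfolding bounded_iff by metis
  obtain d where d: "\<And>s. s \<in> {0..1} \<Longrightarrow> has_cplx_deriv (\<lambda>z. g z s) (d s) z"
    using der[OF z] by metis
  define c where "c = 16 * B / r\<^sup>2"
  have est: "norm (g (z + h) s - g z s - cplx_scale h (d s)) \<le> c * (cmod h)\<^sup>2"
    if "s \<in> {0..1}" "cmod h \<le> r / 2" for h s
    unfolding c_def
  proof (rule has_cplx_deriv_second_order(2)[where U = U and f = "\<lambda>z. g z s", OF _ U r(2,1) _ d[OF that(1)] that(2)])
    show "\<exists>d. has_cplx_deriv (\<lambda>z. g z s) d w" if "w \<in> U" for w
      using der[OF that \<open>s \<in> {0..1}\<close>] .
    show "norm (g w s) \<le> B" if "w \<in> cball z r" for w
      by (rule B, rule image_eqI[of _ _ "(w, s)"]) (use that \<open>s \<in> {0..1}\<close> in simp_all)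
  qed
  have slice: "continuous_on {0..1} (g w)" if "w \<in> U" for w
  proof -
    have "continuous_on {0..1} (\<lambda>s. (\<lambda>(z, s). g z s) (w, s))"
      by (rule continuous_on_compose2[OF cont]) (use that in \<open>auto intro!: continuous_intros\<close>)
    then show ?thesis by simp
  qed
  have zh: "z + h \<in> U" if "cmod h \<le> r / 2" for h
    using that r by (intro subsetD[OF r(2)]) (simp add: dist_norm)
  have dc: "continuous_on {0..1} d"
  proof (rule uniform_limit_theorem)
    define a where "a n = r / 2 * inverse (real (Suc n))" for n
    define h where "h n = complex_of_real (a n)" for n
    have a: "0 < a n" "a n \<le> r / 2" for n
      using r(1) by (auto simp: a_def field_simps)
    have h: "h n \<noteq> 0" "cmod (h n) = a n" for n
      using a(1)[of n] by (auto simp: h_def)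
    then have hr: "cmod (h n) \<le> r / 2" for n
      using a(2) by simp
    show "\<forall>\<^sub>F n in sequentially.
        continuous_on {0..1} (\<lambda>s. cplx_scale (inverse (h n)) (g (z + h n) s - g z s))"
      by (intro always_eventually allI continuous_on_cplx_scale continuous_on_const
          continuous_on_diff slice zh hr z)
    show "uniform_limit {0..1} (\<lambda>n s. cplx_scale (inverse (h n)) (g (z + h n) s - g z s)) d sequentially"
    proof (rule uniform_limitI)
      fix e :: real assume e: "0 < e"
      have "(\<lambda>n. c * a n) \<longlonglongrightarrow> 0"
        unfolding a_def by (intro tendsto_mult_right_zero LIMSEQ_inverse_real_of_nat)
      then have "\<forall>\<^sub>F n in sequentially. c * a n < e"
        using e by (rule order_tendstoD(2))
      then show "\<forall>\<^sub>F n in sequentially.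
          \<forall>s\<in>{0..1}. dist (cplx_scale (inverse (h n)) (g (z + h n) s - g z s)) (d s) < e"
      proof (eventually_elim, intro ballI)
        fix n s assume *: "c * a n < e" "s \<in> {0..1::real}"
        have "cplx_scale (inverse (h n)) (g (z + h n) s - g z s) - d s
            = cplx_scale (inverse (h n)) (g (z + h n) s - g z s - cplx_scale (h n) (d s))"
          using h(1) by (simp add: cplx_scale_diff_right)
        also have "norm \<dots> \<le> inverse (cmod (h n)) * (c * (cmod (h n))\<^sup>2)"
          unfolding norm_cplx_scale norm_inverse
          by (intro mult_left_mono est *(2) hr) auto
        also have "\<dots> = c * cmod (h n)" using h(1)[of n] by (simp add: power2_eq_square)
        finally show "dist (cplx_scale (inverse (h n)) (g (z + h n) s - g z s)) (d s) < e"
          using *(1) h(2) by (simp add: dist_norm)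
      qed
    qed
  qed simp
  have int: "g w integrable_on {0..1}" if "w \<in> U" for w
    by (rule integrable_continuous_real[OF slice[OF that]])
  have intd: "(\<lambda>s. cplx_scale h (d s)) integrable_on {0..1}" for h
    by (intro integrable_continuous_real continuous_on_cplx_scale continuous_on_const dc)
  have second_order: "norm (integral {0..1} (g (z + h)) - integral {0..1} (g z) - cplx_scale h (integral {0..1} d))
      \<le> c * (cmod h)\<^sup>2" if h: "cmod h \<le> r / 2" for h
  proof -
    have "integral {0..1} (\<lambda>s. cplx_scale h (d s)) = cplx_scale h (integral {0..1} d)"
      using integral_linear[OF integrable_continuous_real[OF dc] bounded_linear_cplx_scale[of h]]
      by (simp add: o_def)
    then have "integral {0..1} (g (z + h)) - integral {0..1} (g z) - cplx_scale h (integral {0..1} d)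
        = integral {0..1} (\<lambda>s. g (z + h) s - g z s - cplx_scale h (d s))"
      using int[OF zh[OF h]] int[OF z] intd[of h] by (simp add: integral_diff integrable_diff)
    also have "norm \<dots> \<le> c * (cmod h)\<^sup>2 * (1 - 0)"
      by (rule integral_bound) (use est h z in \<open>auto intro!: continuous_intros continuous_on_cplx_scale dc slice zh\<close>)
    finally show ?thesis by simp
  qed
  have "has_cplx_deriv (\<lambda>z. integral {0..1} (g z)) (integral {0..1} d) z"
    using has_cplx_derivI[OF half_gt_zero[OF r(1)] second_order] .
  then show ?thesis by blast
qed

text \<open>Weierstrass' theorem: the second order estimates of the terms are summable.\<close>

lemma has_cplx_deriv_suminf:
  fixes f :: "nat \<Rightarrow> complex \<Rightarrow> 'a::{real_inner, banach} \<times> 'a"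
  assumes U: "open U" and z: "z \<in> U"
    and der: "\<And>n w. w \<in> U \<Longrightarrow> \<exists>d. has_cplx_deriv (f n) d w"
    and b: "\<And>n w. w \<in> U \<Longrightarrow> norm (f n w) \<le> b n" "summable b"
  shows "\<exists>d. has_cplx_deriv (\<lambda>z. \<Sum>n. f n z) d z"
proof -
  obtain r where r: "0 < r" "cball z r \<subseteq> U" using U z open_contains_cball by blast
  obtain d where d: "\<And>n. has_cplx_deriv (f n) (d n) z" using der[OF z] by metis
  have d_le: "norm (d n) \<le> 2 * b n / r"
    and est: "cmod h \<le> r / 2 \<Longrightarrow> norm (f n (z + h) - f n z - cplx_scale h (d n)) \<le> 16 * b n / r\<^sup>2 * (cmod h)\<^sup>2"
    for n h
    by (rule has_cplx_deriv_second_order[where U = U and f = "f n" and z = z]; use U r der d b in auto)+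
  have sd: "summable d"
    by (rule summable_comparison_test'[of "\<lambda>n. 2 * b n / r" 0])
       (use d_le b(2) in \<open>auto intro!: summable_divide summable_mult\<close>)
  have sf: "summable (\<lambda>n. f n w)" if "w \<in> U" for w
    by (rule summable_comparison_test'[OF b(2), of 0]) (use that b in auto)
  have second_order: "norm ((\<Sum>n. f n (z + h)) - (\<Sum>n. f n z) - cplx_scale h (\<Sum>n. d n))
      \<le> 16 * (\<Sum>n. b n) / r\<^sup>2 * (cmod h)\<^sup>2" if h: "cmod h \<le> r / 2" for h
  proof -
    have zh: "z + h \<in> U" using h r by (intro subsetD[OF r(2)]) (simp add: dist_norm)
    note sdh = bounded_linear.summable[OF bounded_linear_cplx_scale sd, of h]
    have sb: "summable (\<lambda>n. 16 * b n / r\<^sup>2 * (cmod h)\<^sup>2)"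
      using b(2) by (intro summable_mult2 summable_divide summable_mult)
    have "(\<Sum>n. f n (z + h)) - (\<Sum>n. f n z) - cplx_scale h (\<Sum>n. d n)
        = (\<Sum>n. f n (z + h) - f n z - cplx_scale h (d n))"
      using sf[OF zh] sf[OF z] sdh
      by (simp add: bounded_linear.suminf[OF bounded_linear_cplx_scale sd] suminf_diff summable_diff)
    also have "norm \<dots> \<le> (\<Sum>n. 16 * b n / r\<^sup>2 * (cmod h)\<^sup>2)"
    proof -
      have s: "summable (\<lambda>n. norm (f n (z + h) - f n z - cplx_scale h (d n)))"
        by (rule summable_comparison_test'[OF sb, of 0]) (use est[OF h] in auto)
      show ?thesis using summable_norm[OF s] suminf_le[OF est[OF h] s sb] by linarith
    qed
    also have "\<dots> = 16 * (\<Sum>n. b n) / r\<^sup>2 * (cmod h)\<^sup>2"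
      by (intro sums_unique[symmetric] sums_mult2 sums_divide sums_mult summable_sums b(2))
    finally show ?thesis .
  qed
  have "has_cplx_deriv (\<lambda>z. \<Sum>n. f n z) (\<Sum>n. d n) z"
    using has_cplx_derivI[OF half_gt_zero[OF r(1)] second_order] .
  then show ?thesis by blast
qed

section \<open>Holomorphic semigroups on a sector\<close>

text \<open>An analytic semigroup on the complexification, extended by \<open>V 0 = id\<close> to the vertex of the
  sector.\<close>

locale sectorial_semigroup =
  fixes \<theta> :: real and V :: "complex \<Rightarrow> 'a::{real_inner, banach} \<times> 'a \<Rightarrow> 'a \<times> 'a"
  assumes angle: "0 < \<theta>" "\<theta> \<le> pi / 2"
    and V_linear_sector: "z \<in> sector \<theta> \<Longrightarrow> bounded_linear (V z)"
    and V_scale_sector: "z \<in> sector \<theta> \<Longrightarrow> V z (cplx_scale c p) = cplx_scale c (V z p)"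
    and V_add_sector: "z \<in> sector \<theta> \<Longrightarrow> w \<in> sector \<theta> \<Longrightarrow> V (z + w) p = V z (V w p)"
    and V_deriv: "z \<in> sector \<theta> \<Longrightarrow> \<exists>d. has_cplx_deriv (\<lambda>z. V z p) d z"
    and V_at_0: "((\<lambda>z. V z p) \<longlongrightarrow> p) (at 0 within sector \<theta>)"
    and V_0 [simp]: "V 0 p = p"
begin

definition sector0 :: "complex set" where "sector0 = insert 0 (sector \<theta>)"

lemma sector_subset_sector0: "sector \<theta> \<subseteq> sector0" and zero_in_sector0 [simp]: "0 \<in> sector0"
  by (auto simp: sector0_def)

lemma sector0_add: "z \<in> sector0 \<Longrightarrow> w \<in> sector0 \<Longrightarrow> z + w \<in> sector0"
  using sector_add[OF angle] by (auto simp: sector0_def)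

lemma sector0_scale: "z \<in> sector0 \<Longrightarrow> 0 \<le> r \<Longrightarrow> z * of_real r \<in> sector0"
  using sector_scale[OF angle, of z r] by (cases "r = 0") (auto simp: sector0_def)

lemma sector0_scale_compl: "z \<in> sector0 \<Longrightarrow> s \<le> 1 \<Longrightarrow> z * (1 - of_real s) \<in> sector0"
  using sector0_scale[of z "1 - s"] by simp

lemma sector0_of_real [simp]: "0 \<le> r \<Longrightarrow> of_real r \<in> sector0"
  using sector_of_real[OF angle, of r] by (cases "r = 0") (auto simp: sector0_def)

lemma V_linear: "z \<in> sector0 \<Longrightarrow> bounded_linear (V z)"
proof -
  have "V 0 = (\<lambda>p. p)" by auto
  then show "z \<in> sector0 \<Longrightarrow> bounded_linear (V z)"
    using V_linear_sector bounded_linear_ident by (auto simp: sector0_def)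
qed

lemma V_scale: "z \<in> sector0 \<Longrightarrow> V z (cplx_scale c p) = cplx_scale c (V z p)"
  unfolding sector0_def by (elim insertE) (simp_all add: V_scale_sector)

lemma V_add: "z \<in> sector0 \<Longrightarrow> w \<in> sector0 \<Longrightarrow> V (z + w) p = V z (V w p)"
  unfolding sector0_def by (elim insertE) (simp_all add: V_add_sector)

text \<open>Otherwise some \<open>Z n \<rightarrow> 0\<close> in the sector has \<open>\<parallel>V (Z n)\<parallel> > n\<close>, while \<open>V (Z n) p \<rightarrow> p\<close> for every \<open>p\<close>,
  against uniform boundedness.\<close>

lemma V_bounded_near_0:
  "\<exists>\<delta>>0. \<exists>M. \<forall>z\<in>sector \<theta>. cmod z < \<delta> \<longrightarrow> (\<forall>p. norm (V z p) \<le> M * norm p)"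
proof (rule ccontr)
  assume neg: "\<not> ?thesis"
  have "\<exists>z\<in>sector \<theta>. cmod z < inverse (real (Suc n)) \<and> (\<exists>p. \<not> norm (V z p) \<le> real n * norm p)" for n
  proof (rule ccontr)
    assume "\<not> ?thesis"
    then have "\<forall>z\<in>sector \<theta>. cmod z < inverse (real (Suc n)) \<longrightarrow> (\<forall>p. norm (V z p) \<le> real n * norm p)"
      by blast
    moreover have "0 < inverse (real (Suc n))" by simp
    ultimately show False using neg by blast
  qed
  then obtain Z where Z: "\<And>n. Z n \<in> sector \<theta>" "\<And>n. cmod (Z n) < inverse (real (Suc n))"
      "\<And>n. \<exists>p. \<not> norm (V (Z n) p) \<le> real n * norm p"
    by metis
  have "Z \<longlonglongrightarrow> 0"
    by (rule Lim_null_comparison[OF _ LIMSEQ_inverse_real_of_nat])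
       (use Z(2) in \<open>auto intro!: always_eventually less_imp_le\<close>)
  moreover have "Z n \<noteq> 0" for n using Z(1)[of n] zero_notin_sector[OF angle] by auto
  ultimately have filt: "filterlim Z (at 0 within sector \<theta>) sequentially"
    using Z(1) by (simp add: filterlim_at)
  have "\<exists>c. \<forall>n. norm (V (Z n) p) \<le> c" for p
  proof -
    have "(\<lambda>n. V (Z n) p) \<longlonglongrightarrow> p" by (rule filterlim_compose[OF V_at_0 filt])
    then have "bounded (range (\<lambda>n. V (Z n) p))" by (rule convergent_imp_bounded)
    then show ?thesis unfolding bounded_iff by blast
  qed
  with uniform_boundedness[of "\<lambda>n. V (Z n)"] V_linear_sector[OF Z(1)]
  obtain M where M: "\<And>n p. norm (V (Z n) p) \<le> M * norm p" by blast
  obtain n :: nat where n: "M \<le> real n" using real_arch_simple by blast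
  have "norm (V (Z n) p) \<le> real n * norm p" for p
    using M[of n p] mult_right_mono[OF n norm_ge_zero, of p] by linarith
  with Z(3)[of n] show False by blast
qed

text \<open>The semigroup law spreads the bound near the vertex: \<open>V z = (V (z / N)) ^^ N\<close>.\<close>

lemma V_bounded: "\<exists>M>0. \<forall>z\<in>sector0. cmod z \<le> r \<longrightarrow> (\<forall>p. norm (V z p) \<le> M * norm p)"
proof -
  obtain \<delta> M0 where \<delta>: "0 < \<delta>" and
    M0: "\<And>z p. z \<in> sector \<theta> \<Longrightarrow> cmod z < \<delta> \<Longrightarrow> norm (V z p) \<le> M0 * norm p"
    using V_bounded_near_0 by blast
  define M where "M = max 1 M0"
  have M: "norm (V z p) \<le> M * norm p" if "z \<in> sector \<theta>" "cmod z < \<delta>" for z p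
  proof -
    have "M0 * norm p \<le> M * norm p" by (intro mult_right_mono) (auto simp: M_def)
    then show ?thesis using M0[OF that, of p] by linarith
  qed
  obtain n where n: "r / \<delta> < real n" using reals_Archimedean2 by blast
  define N where "N = Suc n"
  have pow: "V (w * of_real (real (Suc m))) p = (V w ^^ Suc m) p" if "w \<in> sector \<theta>" for w m p
  proof (induction m)
    case (Suc m)
    have "w * of_real (real (Suc (Suc m))) = w + w * of_real (real (Suc m))" by (simp add: algebra_simps)
    then have "V (w * of_real (real (Suc (Suc m)))) p = V w (V (w * of_real (real (Suc m))) p)"
      using that sector_scale[OF angle that, of "real (Suc m)"] by (simp only: V_add_sector)
    then show ?case unfolding Suc by simp
  qed simp
  have iter: "norm ((V w ^^ m) p) \<le> M ^ m * norm p" if "w \<in> sector \<theta>" "cmod w < \<delta>" for w m p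
  proof (induction m)
    case (Suc m)
    have "norm ((V w ^^ Suc m) p) \<le> M * norm ((V w ^^ m) p)" using M[OF that] by simp
    also have "\<dots> \<le> M * (M ^ m * norm p)" by (intro mult_left_mono Suc) (simp add: M_def)
    finally show ?case by (simp add: mult_ac)
  qed simp
  have "norm (V z p) \<le> M ^ N * norm p" if z: "z \<in> sector0" "cmod z \<le> r" for z p
  proof (cases "z = 0")
    case True
    have "1 * norm p \<le> M ^ N * norm p" by (intro mult_right_mono one_le_power) (auto simp: M_def)
    with True show ?thesis by simp
  next
    case False
    define w where "w = z * of_real (1 / real N)"
    have w: "w \<in> sector \<theta>"
      unfolding w_def by (rule sector_scale[OF angle]) (use False z in \<open>auto simp: sector0_def N_def\<close>)
    have "r < \<delta> * real N" using n \<delta> by (simp add: N_def field_simps)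
    moreover have "cmod w = cmod z / real N" unfolding w_def norm_mult norm_of_real by simp
    ultimately have "cmod w * real N < \<delta> * real N" using z(2) by (simp add: N_def)
    then have "cmod w < \<delta>" by (simp add: N_def)
    moreover have "z = w * of_real (real N)"
      unfolding w_def mult.assoc of_real_mult[symmetric] by (simp add: N_def)
    ultimately show ?thesis using iter[OF w, of N p] pow[OF w, of n p] by (simp only: N_def)
  qed
  moreover have "0 < M ^ N" by (simp add: M_def)
  ultimately show ?thesis by blast
qed

definition growth :: "real \<Rightarrow> real" where
  "growth r = (SOME M. 0 < M \<and> (\<forall>z\<in>sector0. cmod z \<le> r \<longrightarrow> (\<forall>p. norm (V z p) \<le> M * norm p)))"

lemma growth_pos: "0 < growth r"
  and norm_V_le: "z \<in> sector0 \<Longrightarrow> cmod z \<le> r \<Longrightarrow> norm (V z p) \<le> growth r * norm p"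
  using someI_ex[OF V_bounded, of r] unfolding growth_def by blast+

lemma continuous_on_orbit: "continuous_on sector0 (\<lambda>z. V z p)"
  unfolding continuous_on_def
proof
  fix z assume "z \<in> sector0"
  then consider "z = 0" | "z \<in> sector \<theta>" by (auto simp: sector0_def)
  then show "((\<lambda>z. V z p) \<longlongrightarrow> V z p) (at z within sector0)"
  proof cases
    case 1
    have "at 0 within sector0 = at 0 within sector \<theta>" by (simp add: at_within_def sector0_def)
    with V_at_0 1 show ?thesis by simp
  next
    case 2
    then obtain d where "has_cplx_deriv (\<lambda>z. V z p) d z" using V_deriv by blast
    then have "isCont (\<lambda>z. V z p) z" by (rule has_cplx_deriv_isCont)
    then show ?thesis unfolding isCont_def by (rule tendsto_within_subset) simp
  qed
qed

text \<open>Strong continuity together with local boundedness is joint continuity.\<close>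

lemma tendsto_V:
  assumes f: "(f \<longlongrightarrow> z) F" and g: "(g \<longlongrightarrow> p) F" and ev: "\<forall>\<^sub>F x in F. f x \<in> sector0" and z: "z \<in> sector0"
  shows "((\<lambda>x. V (f x) (g x)) \<longlongrightarrow> V z p) F"
proof -
  define M where "M = growth (cmod z + 1)"
  have "((\<lambda>x. V (f x) p) \<longlongrightarrow> V z p) F"
    by (rule continuous_on_tendsto_compose[OF continuous_on_orbit f z ev])
  moreover have "((\<lambda>x. V (f x) (g x - p)) \<longlongrightarrow> 0) F"
  proof (rule Lim_null_comparison)
    have "\<forall>\<^sub>F x in F. cmod (f x) < cmod z + 1"
      by (rule order_tendstoD(2)[OF tendsto_norm[OF f]]) simp
    with ev show "\<forall>\<^sub>F x in F. norm (V (f x) (g x - p)) \<le> M * norm (g x - p)"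
      by eventually_elim (auto simp: M_def intro: norm_V_le)
    show "((\<lambda>x. M * norm (g x - p)) \<longlongrightarrow> 0) F"
      by (intro tendsto_mult_right_zero tendsto_norm_zero LIM_zero g)
  qed
  ultimately have "((\<lambda>x. V (f x) p + V (f x) (g x - p)) \<longlongrightarrow> V z p + 0) F" by (rule tendsto_add)
  moreover have "\<forall>\<^sub>F x in F. V (f x) p + V (f x) (g x - p) = V (f x) (g x)"
    using ev by eventually_elim (simp add: linear_simps[OF V_linear])
  ultimately show ?thesis by (simp add: tendsto_cong)
qed

lemma continuous_on_V:
  assumes "continuous_on A f" "continuous_on A g" "\<And>x. x \<in> A \<Longrightarrow> f x \<in> sector0"
  shows "continuous_on A (\<lambda>x. V (f x) (g x))"
  using assms unfolding continuous_on_def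
  by (auto intro!: tendsto_V simp: eventually_at_filter)

text \<open>The product rule, with joint continuity of \<open>V\<close> giving the limit of the first part of the difference
  quotient.\<close>

lemma has_cplx_deriv_V:
  assumes z: "z \<in> sector \<theta>" and v: "has_cplx_deriv v v' z"
  shows "\<exists>d. has_cplx_deriv (\<lambda>z. V z (v z)) d z"
proof -
  obtain e where e: "has_cplx_deriv (\<lambda>w. V w (v z)) e z" using V_deriv[OF z] by blast
  have add: "((\<lambda>h. z + h) \<longlongrightarrow> z) (at 0)" by (intro tendsto_eq_intros) auto
  have ev: "\<forall>\<^sub>F h in at 0. z + h \<in> sector \<theta>"
    using topological_tendstoD[OF add open_sector[OF angle] z] .
  then have evc: "\<forall>\<^sub>F h in at 0. z + h \<in> sector0" by eventually_elim (simp add: sector0_def)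
  have zc: "z \<in> sector0" using z by (simp add: sector0_def)
  have "((\<lambda>h. V (z + h) (cplx_scale (inverse h) (v (z + h) - v z))
      + cplx_scale (inverse h) (V (z + h) (v z) - V z (v z))) \<longlongrightarrow> V z v' + e) (at 0)"
    using v e unfolding has_cplx_deriv_def by (intro tendsto_add tendsto_V add evc zc)
  moreover have "\<forall>\<^sub>F h in at 0. V (z + h) (cplx_scale (inverse h) (v (z + h) - v z))
      + cplx_scale (inverse h) (V (z + h) (v z) - V z (v z))
      = cplx_scale (inverse h) (V (z + h) (v (z + h)) - V z (v z))"
    using evc
  proof eventually_elim
    case (elim h)
    then show ?case
      by (simp add: V_scale linear_simps[OF V_linear] cplx_scale_diff_right)
  qed
  ultimately have "has_cplx_deriv (\<lambda>z. V z (v z)) (V z v' + e) z"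
    unfolding has_cplx_deriv_def by (simp add: tendsto_cong)
  then show ?thesis by blast
qed

text \<open>The functionals reduce this to the scalar identity theorem; the positive half line accumulates at \<open>1\<close>.\<close>

lemma eq_on_sector:
  assumes f: "\<And>z. z \<in> sector \<theta> \<Longrightarrow> \<exists>d. has_cplx_deriv f d z"
    and g: "\<And>z. z \<in> sector \<theta> \<Longrightarrow> \<exists>d. has_cplx_deriv g d z"
    and eq: "\<And>t. 0 < t \<Longrightarrow> f (of_real t) = g (of_real t)" and z: "z \<in> sector \<theta>"
  shows "f z = g z"
proof (rule cplx_functional_eqI)
  fix q
  have hol: "(\<lambda>z. cplx_functional q (f z)) holomorphic_on sector \<theta>"
    "(\<lambda>z. cplx_functional q (g z)) holomorphic_on sector \<theta>"
    using f g has_cplx_deriv_functional open_sector[OF angle] by (subst holomorphic_on_open; blast)+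
  have "cplx_functional q (f z) - cplx_functional q (g z) = 0"
  proof (rule analytic_continuation[where f = "\<lambda>z. cplx_functional q (f z) - cplx_functional q (g z)"
        and S = "sector \<theta>" and U = "of_real ` {0<..}" and \<xi> = 1])
    show "(\<lambda>z. cplx_functional q (f z) - cplx_functional q (g z)) holomorphic_on sector \<theta>"
      by (intro holomorphic_on_diff hol)
    show "open (sector \<theta>)" "connected (sector \<theta>)"
      using open_sector[OF angle] convex_connected[OF convex_sector[OF angle]] by auto
    show "complex_of_real ` {0<..} \<subseteq> sector \<theta>" "1 \<in> sector \<theta>"
      using sector_of_real[OF angle] sector_of_real[OF angle, of 1] by auto
    show "1 islimpt complex_of_real ` {0<..}"
      unfolding islimpt_sequential
    proof (intro exI[of _ "\<lambda>n. complex_of_real (1 + inverse (real (Suc n)))"] conjI allI)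
      fix n
      show "complex_of_real (1 + inverse (real (Suc n))) \<in> complex_of_real ` {0<..} - {1}"
      proof -
        have p: "0 < inverse (real (Suc n))" by simp
        then have "complex_of_real (1 + inverse (real (Suc n))) \<noteq> of_real 1"
          unfolding of_real_eq_iff by simp
        moreover have "0 < 1 + inverse (real (Suc n))" using p by linarith
        ultimately show ?thesis by (simp only: of_real_1 Diff_iff singleton_iff imageI greaterThan_iff) simp
      qed
      show "(\<lambda>n. complex_of_real (1 + inverse (real (Suc n)))) \<longlonglongrightarrow> 1"
        using tendsto_of_real[OF LIMSEQ_inverse_real_of_nat_add[of 1], where 'a = complex] by simp
    qed
    show "cplx_functional q (f w) - cplx_functional q (g w) = 0"
      if "w \<in> complex_of_real ` {0<..}" for w using that eq by auto
  qed (use z in auto)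
  then show "cplx_functional q (f z) = cplx_functional q (g z)" by simp
qed

end

section \<open>The Dyson series of a bounded perturbation\<close>

lemma integral_power_unit: "integral {0..1} (\<lambda>s::real. c * s ^ j) = c / (real j + 1)"
  and integrable_power_unit: "(\<lambda>s::real. c * s ^ j) integrable_on {0..1}"
proof -
  have "((\<lambda>s::real. c * s ^ j) has_integral (c * 1 ^ Suc j / real (Suc j) - c * 0 ^ Suc j / real (Suc j))) {0..1}"
    by (rule fundamental_theorem_of_calculus)
       (auto intro!: derivative_eq_intros simp flip: has_real_derivative_iff_has_vector_derivative
         simp del: power_Suc of_nat_Suc)
  then have "((\<lambda>s::real. c * s ^ j) has_integral c / (real j + 1)) {0..1}"
    by (simp add: add.commute)
  then show "integral {0..1} (\<lambda>s::real. c * s ^ j) = c / (real j + 1)"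
    and "(\<lambda>s::real. c * s ^ j) integrable_on {0..1}" by (rule integral_unique, rule has_integral_integrable)
qed

locale sectorial_perturbation = sectorial_semigroup \<theta> V
  for \<theta> and V :: "complex \<Rightarrow> 'a::{real_inner, banach} \<times> 'a \<Rightarrow> 'a \<times> 'a" +
  fixes K :: "'a \<times> 'a \<Rightarrow> 'a \<times> 'a"
  assumes K_linear: "bounded_linear K"
    and K_scale: "K (cplx_scale c p) = cplx_scale c (K p)"
begin

text \<open>The variation of constants integral \<open>\<integral> V(z-\<zeta>) K (f \<zeta>) d\<zeta>\<close> along the segment from \<open>0\<close> to \<open>z\<close>. The
  parametrisation by \<open>[0,1]\<close> keeps the interval fixed, so that dependence on \<open>z\<close> is dependence on a
  parameter of the integrand.\<close>

definition duhamel :: "(complex \<Rightarrow> 'a \<times> 'a) \<Rightarrow> complex \<Rightarrow> 'a \<times> 'a" where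
  "duhamel f z =
     integral {0..1} (\<lambda>s. cplx_scale z (V (z * of_real (1 - s)) (K (f (z * of_real s)))))"

lemma continuous_on_duhamel_integrand:
  assumes f: "continuous_on sector0 f"
  shows "continuous_on (sector0 \<times> {0..1})
      (\<lambda>(z, s). cplx_scale z (V (z * of_real (1 - s)) (K (f (z * of_real s)))))"
  unfolding split_beta
  by (intro continuous_on_cplx_scale continuous_on_V bounded_linear.continuous_on[OF K_linear]
      continuous_on_compose2[OF f] continuous_intros)
     (auto intro: sector0_scale sector0_scale_compl)

lemma duhamel_integrand_continuous:
  assumes f: "continuous_on sector0 f" and z: "z \<in> sector0"
  shows "continuous_on {0..1} (\<lambda>s. cplx_scale z (V (z * of_real (1 - s)) (K (f (z * of_real s)))))"
proof -
  have "continuous_on {0..1} (\<lambda>s. (\<lambda>(z, s). cplx_scale z (V (z * of_real (1 - s)) (K (f (z * of_real s))))) (z, s))"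
    by (rule continuous_on_compose2[OF continuous_on_duhamel_integrand[OF f]])
       (use z in \<open>auto intro!: continuous_intros\<close>)
  then show ?thesis by simp
qed

lemmas duhamel_integrable = integrable_continuous_real[OF duhamel_integrand_continuous]

lemma continuous_on_duhamel:
  assumes "continuous_on sector0 f"
  shows "continuous_on sector0 (duhamel f)"
  using integral_continuous_on_param[of sector0 0 1 "\<lambda>z s. cplx_scale z (V (z * of_real (1 - s)) (K (f (z * of_real s))))"]
    continuous_on_duhamel_integrand[OF assms]
  unfolding duhamel_def[abs_def] cbox_interval by blast

lemma norm_duhamel_le:
  assumes f: "continuous_on sector0 f" and z: "z \<in> sector0" "cmod z \<le> r"
    and c: "\<And>s. 0 \<le> s \<Longrightarrow> s \<le> 1 \<Longrightarrow> norm (f (z * of_real s)) \<le> c * s ^ j"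
  shows "norm (duhamel f z) \<le> growth r * onorm K * cmod z * c / (real j + 1)"
proof -
  let ?C = "cmod z * (growth r * (onorm K * c))"
  have "norm (duhamel f z) \<le> integral {0..1} (\<lambda>s. ?C * s ^ j)"
    unfolding duhamel_def
  proof (rule integral_norm_bound_integral[OF duhamel_integrable[OF f z(1)] integrable_power_unit])
    fix s :: real assume s: "s \<in> {0..1}"
    have "cmod (z * of_real (1 - s)) \<le> r"
      using z(2) s mult_left_le[of "1 - s" "cmod z"] unfolding norm_mult norm_of_real by simp
    then have "norm (V (z * of_real (1 - s)) (K (f (z * of_real s)))) \<le> growth r * norm (K (f (z * of_real s)))"
      using s by (intro norm_V_le sector0_scale z) auto
    also have "\<dots> \<le> growth r * (onorm K * norm (f (z * of_real s)))"
      by (intro mult_left_mono onorm[OF K_linear] less_imp_le[OF growth_pos])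
    also have "\<dots> \<le> growth r * (onorm K * (c * s ^ j))"
      using s by (intro mult_left_mono c less_imp_le[OF growth_pos] onorm_pos_le[OF K_linear]) auto
    finally show "norm (cplx_scale z (V (z * of_real (1 - s)) (K (f (z * of_real s))))) \<le> ?C * s ^ j"
      by (simp add: mult_left_mono mult.assoc)
  qed
  then show ?thesis unfolding integral_power_unit by (simp add: mult_ac)
qed

lemma duhamel_cong:
  assumes "\<And>w. w \<in> sector0 \<Longrightarrow> f w = g w" "z \<in> sector0"
  shows "duhamel f z = duhamel g z"
  unfolding duhamel_def using assms by (intro integral_cong) (simp add: sector0_scale)

lemma duhamel_add:
  assumes "continuous_on sector0 f" "continuous_on sector0 g" "z \<in> sector0"
  shows "duhamel (\<lambda>w. f w + g w) z = duhamel f z + duhamel g z"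
  unfolding duhamel_def
    integral_add[OF duhamel_integrable[OF assms(1,3)] duhamel_integrable[OF assms(2,3)], symmetric]
  using assms(3)
  by (intro integral_cong) (simp add: linear_simps(1)[OF K_linear] linear_simps(1)[OF V_linear]
      sector0_scale_compl cplx_scale_add_right)

lemma duhamel_scale:
  assumes "continuous_on sector0 f" "z \<in> sector0"
  shows "duhamel (\<lambda>w. cplx_scale c (f w)) z = cplx_scale c (duhamel f z)"
proof -
  have "cplx_scale c (duhamel f z) = integral {0..1} (cplx_scale c \<circ>
      (\<lambda>s. cplx_scale z (V (z * of_real (1 - s)) (K (f (z * of_real s))))))"
    unfolding duhamel_def
    by (rule integral_linear[OF duhamel_integrable[OF assms] bounded_linear_cplx_scale, symmetric])
  also have "\<dots> = duhamel (\<lambda>w. cplx_scale c (f w)) z"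
    unfolding duhamel_def o_def
    by (rule integral_cong) (simp add: K_scale V_scale sector0_scale_compl assms(2) mult.commute)
  finally show ?thesis by simp
qed

lemma duhamel_diff:
  assumes "continuous_on sector0 f" "continuous_on sector0 g" "z \<in> sector0"
  shows "duhamel (\<lambda>w. f w - g w) z = duhamel f z - duhamel g z"
proof -
  have "duhamel (\<lambda>w. f w - g w + g w) z = duhamel (\<lambda>w. f w - g w) z + duhamel g z"
    by (intro duhamel_add continuous_on_diff assms)
  then show ?thesis by simp
qed

lemma duhamel_0 [simp]: "duhamel f 0 = 0"
  by (simp add: duhamel_def)

text \<open>For fixed \<open>s\<close> the integrand is holomorphic in \<open>z\<close>. At \<open>s = 0\<close> and \<open>s = 1\<close> one of the arguments sits
  at the vertex, where nothing is differentiable, but there the corresponding factor does not depend on \<open>z\<close>.\<close>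

lemma duhamel_deriv:
  assumes f: "continuous_on sector0 f" and der: "\<And>z. z \<in> sector \<theta> \<Longrightarrow> \<exists>d. has_cplx_deriv f d z"
    and z: "z \<in> sector \<theta>"
  shows "\<exists>d. has_cplx_deriv (duhamel f) d z"
  unfolding duhamel_def[abs_def]
proof (rule has_cplx_deriv_integral[OF open_sector[OF angle] _ _ z])
  show "continuous_on (sector \<theta> \<times> {0..1})
      (\<lambda>(z, s). cplx_scale z (V (z * of_real (1 - s)) (K (f (z * of_real s)))))"
    by (rule continuous_on_subset[OF continuous_on_duhamel_integrand[OF f]])
       (use sector_subset_sector0 in auto)
  fix w :: complex and s :: real assume w: "w \<in> sector \<theta>" and s: "s \<in> {0..1}"
  have K: "\<exists>d. has_cplx_deriv (\<lambda>z. K (f (z * of_real s))) d w" if "w \<in> sector \<theta>" for w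
  proof -
    have "\<exists>d. has_cplx_deriv (\<lambda>z. f (z * of_real s)) d w"
    proof (cases "s = 0")
      case True
      then show ?thesis using has_cplx_deriv_const[of "f 0" w] by (simp only: of_real_0 mult_zero_right) blast
    next
      case False
      with s that have "w * of_real s \<in> sector \<theta>" by (intro sector_scale[OF angle]) auto
      then show ?thesis using der has_cplx_deriv_comp_scale by blast
    qed
    then show ?thesis using has_cplx_deriv_linear[OF K_linear K_scale] by blast
  qed
  have "\<exists>d. has_cplx_deriv (\<lambda>z. V (z * of_real (1 - s)) (K (f (z * of_real s)))) d w"
  proof (cases "s = 1")
    case True
    then show ?thesis using K[OF w] by simp
  next
    case False
    \<comment> \<open>Substituting \<open>z * r\<close> for \<open>z\<close> makes the product rule applicable with \<open>V z\<close> as operator factor.\<close>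
    define r where "r = 1 - s"
    have r: "0 < r" using False s by (simp add: r_def)
    have cancel: "z * of_real r * of_real (1 / r) = z" for z :: complex using r by simp
    obtain d where "has_cplx_deriv (\<lambda>z. K (f (z * of_real s))) d (w * of_real r * of_real (1 / r))"
      using K[OF w] unfolding cancel by blast
    from has_cplx_deriv_V[OF _ has_cplx_deriv_comp_scale[OF this]] sector_scale[OF angle w r]
    obtain e where "has_cplx_deriv (\<lambda>z. V z (K (f (z * of_real (1 / r) * of_real s)))) e (w * of_real r)"
      by blast
    from has_cplx_deriv_comp_scale[OF this] show ?thesis unfolding cancel unfolding r_def by blast
  qed
  then show "\<exists>d. has_cplx_deriv (\<lambda>z. cplx_scale z (V (z * of_real (1 - s)) (K (f (z * of_real s))))) d w"
    using has_cplx_deriv_scale by blast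
qed

primrec dyson :: "nat \<Rightarrow> 'a \<times> 'a \<Rightarrow> complex \<Rightarrow> 'a \<times> 'a" where
  "dyson 0 p = (\<lambda>z. V z p)"
| "dyson (Suc j) p = duhamel (dyson j p)"

lemma continuous_on_dyson: "continuous_on sector0 (dyson j p)"
  by (induction j) (auto intro: continuous_on_orbit continuous_on_duhamel)

lemma dyson_deriv: "z \<in> sector \<theta> \<Longrightarrow> \<exists>d. has_cplx_deriv (dyson j p) d z"
proof (induction j arbitrary: z)
  case (Suc j)
  show ?case
    unfolding dyson.simps by (rule duhamel_deriv[OF continuous_on_dyson Suc.IH Suc.prems])
qed (simp only: dyson.simps V_deriv)

lemma dyson_add: "z \<in> sector0 \<Longrightarrow> dyson j (p + q) z = dyson j p z + dyson j q z"
proof (induction j arbitrary: z)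
  case (Suc j)
  have "dyson (Suc j) (p + q) z = duhamel (\<lambda>z. dyson j p z + dyson j q z) z"
    unfolding dyson.simps by (rule duhamel_cong[OF Suc.IH Suc.prems])
  also have "\<dots> = dyson (Suc j) p z + dyson (Suc j) q z"
    using Suc.prems by (simp add: duhamel_add continuous_on_dyson)
  finally show ?case .
qed (simp add: linear_simps[OF V_linear])

lemma dyson_scale: "z \<in> sector0 \<Longrightarrow> dyson j (cplx_scale c p) z = cplx_scale c (dyson j p z)"
proof (induction j arbitrary: z)
  case (Suc j)
  have "dyson (Suc j) (cplx_scale c p) z = duhamel (\<lambda>z. cplx_scale c (dyson j p z)) z"
    unfolding dyson.simps by (rule duhamel_cong[OF Suc.IH Suc.prems])
  also have "\<dots> = cplx_scale c (dyson (Suc j) p z)"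
    using Suc.prems by (simp add: duhamel_scale continuous_on_dyson)
  finally show ?case .
qed (simp add: V_scale)

text \<open>The step from \<open>j\<close> to \<open>j + 1\<close> in the factorial estimates, used both for the convergence of the Dyson
  series and for the uniqueness of solutions of Duhamel's equation.\<close>

lemma duhamel_power_step:
  assumes f: "continuous_on sector0 f" and z: "z \<in> sector0" "cmod z \<le> r"
    and c: "\<And>s. 0 \<le> s \<Longrightarrow> s \<le> 1 \<Longrightarrow>
      norm (f (z * of_real s)) \<le> c * (growth r * onorm K * cmod (z * of_real s)) ^ j / fact j"
  shows "norm (duhamel f z) \<le> c * (growth r * onorm K * cmod z) ^ Suc j / fact (Suc j)"
proof -
  let ?x = "growth r * onorm K * cmod z"
  have "norm (duhamel f z) \<le> growth r * onorm K * cmod z * (c * ?x ^ j / fact j) / (real j + 1)"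
  proof (rule norm_duhamel_le[OF f z])
    fix s :: real assume s: "0 \<le> s" "s \<le> 1"
    then show "norm (f (z * of_real s)) \<le> c * ?x ^ j / fact j * s ^ j"
      using c[OF s] by (simp add: norm_mult power_mult_distrib mult_ac)
  qed
  also have "\<dots> = c * ?x ^ Suc j / fact (Suc j)" by (simp add: field_simps)
  finally show ?thesis .
qed

lemma norm_dyson_le:
  "z \<in> sector0 \<Longrightarrow> cmod z \<le> r \<Longrightarrow>
    norm (dyson j p z) \<le> growth r * norm p * (growth r * onorm K * cmod z) ^ j / fact j"
proof (induction j arbitrary: z)
  case 0
  then show ?case using norm_V_le[of z r p] by simp
next
  case (Suc j)
  have "norm (duhamel (dyson j p) z)
      \<le> growth r * norm p * (growth r * onorm K * cmod z) ^ Suc j / fact (Suc j)"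
  proof (rule duhamel_power_step[OF continuous_on_dyson Suc.prems])
    fix s :: real assume s: "0 \<le> s" "s \<le> 1"
    show "norm (dyson j p (z * of_real s))
        \<le> growth r * norm p * (growth r * onorm K * cmod (z * of_real s)) ^ j / fact j"
    proof (rule Suc.IH)
      show "z * of_real s \<in> sector0" using Suc.prems s by (intro sector0_scale)
      show "cmod (z * of_real s) \<le> r"
        using Suc.prems(2) s mult_left_le[of s "cmod z"] by (simp add: norm_mult)
    qed
  qed
  then show ?case by (simp only: dyson.simps)
qed

definition dyson_bound :: "real \<Rightarrow> 'a \<times> 'a \<Rightarrow> nat \<Rightarrow> real" where
  "dyson_bound r p j = growth r * norm p * ((growth r * onorm K * r) ^ j / fact j)"

lemma norm_dyson_le_bound:
  assumes "z \<in> sector0" "cmod z \<le> r"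
  shows "norm (dyson j p z) \<le> dyson_bound r p j"
proof -
  note g = less_imp_le[OF growth_pos, of r]
  have "norm (dyson j p z) \<le> growth r * norm p * ((growth r * onorm K * cmod z) ^ j / fact j)"
    using norm_dyson_le[OF assms] by simp
  also have "\<dots> \<le> growth r * norm p * ((growth r * onorm K * r) ^ j / fact j)"
    using assms(2) g onorm_pos_le[OF K_linear]
    by (intro mult_left_mono divide_right_mono power_mono) auto
  finally show ?thesis by (simp add: dyson_bound_def)
qed

lemma summable_dyson_bound: "summable (dyson_bound r p)"
  unfolding dyson_bound_def using summable_exp[of "growth r * onorm K * r"]
  by (intro summable_mult) (simp add: divide_inverse mult.commute)

lemma summable_dyson: "z \<in> sector0 \<Longrightarrow> summable (\<lambda>j. dyson j p z)"
  by (rule summable_comparison_test'[OF summable_dyson_bound[of "cmod z" p], of 0])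
     (simp add: norm_dyson_le_bound)

definition perturbed :: "complex \<Rightarrow> 'a \<times> 'a \<Rightarrow> 'a \<times> 'a" where
  "perturbed z p = (\<Sum>j. dyson j p z)"

lemma continuous_on_perturbed: "continuous_on sector0 (\<lambda>z. perturbed z p)"
  unfolding continuous_on_def
proof
  fix z assume z: "z \<in> sector0"
  define r where "r = cmod z + 1"
  have lim: "uniform_limit (sector0 \<inter> ball 0 r) (\<lambda>n z. \<Sum>j<n. dyson j p z) (\<lambda>z. perturbed z p) sequentially"
    unfolding perturbed_def
    by (rule Weierstrass_m_test[OF _ summable_dyson_bound[of r p]]) (auto intro: norm_dyson_le_bound)
  have "continuous_on (sector0 \<inter> ball 0 r) (\<lambda>z. perturbed z p)"
    by (rule uniform_limit_theorem[OF _ lim])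
       (auto intro!: always_eventually continuous_on_sum continuous_on_subset[OF continuous_on_dyson])
  moreover have "z \<in> sector0 \<inter> ball 0 r" using z by (simp add: r_def)
  ultimately have "((\<lambda>z. perturbed z p) \<longlongrightarrow> perturbed z p) (at z within sector0 \<inter> ball 0 r)"
    by (simp add: continuous_on_def)
  moreover have "at z within sector0 \<inter> ball 0 r = at z within sector0"
    by (rule at_within_nhd[of _ "ball 0 r"]) (auto simp: r_def)
  ultimately show "((\<lambda>z. perturbed z p) \<longlongrightarrow> perturbed z p) (at z within sector0)" by simp
qed

lemma perturbed_deriv:
  assumes "z \<in> sector \<theta>"
  shows "\<exists>d. has_cplx_deriv (\<lambda>z. perturbed z p) d z"
  unfolding perturbed_def
proof (rule has_cplx_deriv_suminf)
  define r where "r = cmod z + 1"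
  show "open (sector \<theta> \<inter> ball 0 r)" using open_sector[OF angle] by auto
  show "z \<in> sector \<theta> \<inter> ball 0 r" using assms by (simp add: r_def)
  show "\<exists>d. has_cplx_deriv (dyson n p) d w" if "w \<in> sector \<theta> \<inter> ball 0 r" for n w
    using that dyson_deriv by blast
  show "norm (dyson n p w) \<le> dyson_bound r p n" if "w \<in> sector \<theta> \<inter> ball 0 r" for n w
    using that by (intro norm_dyson_le_bound) (auto simp: sector0_def)
  show "summable (dyson_bound r p)" by (rule summable_dyson_bound)
qed

lemma perturbed_add: "z \<in> sector0 \<Longrightarrow> perturbed z (p + q) = perturbed z p + perturbed z q"
  unfolding perturbed_def by (simp add: dyson_add suminf_add summable_dyson)

lemma perturbed_scale: "z \<in> sector0 \<Longrightarrow> perturbed z (cplx_scale c p) = cplx_scale c (perturbed z p)"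
  unfolding perturbed_def
  by (simp add: dyson_scale bounded_linear.suminf[OF bounded_linear_cplx_scale summable_dyson])

lemma perturbed_linear:
  assumes z: "z \<in> sector0"
  shows "bounded_linear (perturbed z)"
proof (rule bounded_linear_intro[where K = "\<Sum>j. growth (cmod z) * ((growth (cmod z) * onorm K * cmod z) ^ j / fact j)"])
  show "perturbed z (p + q) = perturbed z p + perturbed z q" for p q
    by (rule perturbed_add[OF z])
  show "perturbed z (r *\<^sub>R p) = r *\<^sub>R perturbed z p" for r p
    using perturbed_scale[OF z, of "of_real r"] by simp
  fix p
  let ?b = "\<lambda>j. growth (cmod z) * ((growth (cmod z) * onorm K * cmod z) ^ j / fact j)"
  have b: "summable ?b"
    using summable_exp[of "growth (cmod z) * onorm K * cmod z"]
    by (intro summable_mult) (simp add: divide_inverse mult.commute)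
  have le: "norm (dyson j p z) \<le> norm p * ?b j" for j
    using norm_dyson_le_bound[OF z order_refl, of j p] by (simp add: dyson_bound_def mult_ac)
  have s: "summable (\<lambda>j. norm (dyson j p z))"
    by (rule summable_comparison_test'[OF summable_mult[OF b], of 0]) (use le in simp)
  have "norm (perturbed z p) \<le> (\<Sum>j. norm (dyson j p z))"
    unfolding perturbed_def by (rule summable_norm[OF s])
  also have "\<dots> \<le> (\<Sum>j. norm p * ?b j)" by (rule suminf_le[OF le s summable_mult[OF b]])
  also have "\<dots> = norm p * (\<Sum>j. ?b j)" by (rule suminf_mult[OF b])
  finally show "norm (perturbed z p) \<le> norm p * (\<Sum>j. ?b j)" .
qed

lemma duhamel_sum:
  assumes "z \<in> sector0"
  shows "duhamel (\<lambda>w. \<Sum>j<n. dyson j p w) z = (\<Sum>j<n. dyson (Suc j) p z)"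
proof (induction n)
  case 0
  have "duhamel (\<lambda>w. cplx_scale 0 (dyson 0 p w)) z = cplx_scale 0 (duhamel (dyson 0 p) z)"
    by (rule duhamel_scale[OF continuous_on_dyson assms])
  then show ?case by simp
next
  case (Suc n)
  have "duhamel (\<lambda>w. \<Sum>j<Suc n. dyson j p w) z = duhamel (\<lambda>w. \<Sum>j<n. dyson j p w) z + duhamel (dyson n p) z"
    using duhamel_add[OF continuous_on_sum continuous_on_dyson[of n p] assms, of "{..<n}" "\<lambda>j. dyson j p"]
    by (simp add: continuous_on_dyson)
  then show ?case by (simp add: Suc)
qed

text \<open>The partial sums satisfy the equation up to a shift of the index, and \<^const>\<open>duhamel\<close> maps the tails
  of the series to sequences tending to \<open>0\<close>.\<close>

lemma perturbed_integral_equation: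
  assumes z: "z \<in> sector0"
  shows "perturbed z p = V z p + duhamel (\<lambda>w. perturbed w p) z"
proof -
  define r where "r = cmod z"
  define tail where "tail n = (\<Sum>j. dyson_bound r p (j + n))" for n
  define C where "C = growth r * onorm K * cmod z"
  have "tail \<longlonglongrightarrow> 0"
    unfolding tail_def by (rule suminf_exist_split2[OF summable_dyson_bound])
  then have lim: "(\<lambda>n. C * tail n) \<longlonglongrightarrow> 0" by (rule tendsto_mult_right_zero)
  have le: "norm (duhamel (\<lambda>w. perturbed w p) z - (\<Sum>j<n. dyson (Suc j) p z)) \<le> C * tail n" for n
  proof -
    have cont: "continuous_on sector0 (\<lambda>w. \<Sum>j<n. dyson j p w)"
      by (intro continuous_on_sum continuous_on_dyson)
    have "norm (duhamel (\<lambda>w. perturbed w p - (\<Sum>j<n. dyson j p w)) z) \<le> growth r * onorm K * cmod z * tail n / (real 0 + 1)"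
    proof (rule norm_duhamel_le[OF continuous_on_diff[OF continuous_on_perturbed cont] z])
      show "cmod z \<le> r" by (simp add: r_def)
      fix s :: real assume s: "0 \<le> s" "s \<le> 1"
      let ?w = "z * of_real s"
      have w: "?w \<in> sector0" "cmod ?w \<le> r"
        using z s mult_left_le[of s "cmod z"] by (auto simp: sector0_scale norm_mult r_def)
      have sb: "summable (\<lambda>j. dyson_bound r p (j + n))"
        by (rule summable_ignore_initial_segment[OF summable_dyson_bound])
      have sn: "summable (\<lambda>j. norm (dyson (j + n) p ?w))"
        by (rule summable_comparison_test'[OF sb, of 0]) (use norm_dyson_le_bound[OF w] in simp)
      have "perturbed ?w p - (\<Sum>j<n. dyson j p ?w) = (\<Sum>j. dyson (j + n) p ?w)"
        unfolding perturbed_def by (subst suminf_split_initial_segment[OF summable_dyson[OF w(1)], of _ n]) simp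
      also have "norm \<dots> \<le> (\<Sum>j. norm (dyson (j + n) p ?w))" by (rule summable_norm[OF sn])
      also have "\<dots> \<le> tail n"
        unfolding tail_def by (rule suminf_le[OF norm_dyson_le_bound[OF w] sn sb])
      finally show "norm (perturbed ?w p - (\<Sum>j<n. dyson j p ?w)) \<le> tail n * s ^ 0" by simp
    qed
    then show ?thesis
      by (simp add: duhamel_diff[OF continuous_on_perturbed cont z] duhamel_sum[OF z] C_def)
  qed
  have "(\<lambda>n. duhamel (\<lambda>w. perturbed w p) z - (\<Sum>j<n. dyson (Suc j) p z)) \<longlonglongrightarrow> 0"
    by (rule Lim_null_comparison[OF always_eventually lim]) (rule allI, rule le)
  from tendsto_diff[OF tendsto_const this, of "duhamel (\<lambda>w. perturbed w p) z"]
  have "(\<lambda>n. \<Sum>j<n. dyson (Suc j) p z) \<longlonglongrightarrow> duhamel (\<lambda>w. perturbed w p) z"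
    by (simp only: diff_diff_eq2 add_diff_cancel_left' diff_0_right)
  then have "(\<lambda>j. dyson (Suc j) p z) sums duhamel (\<lambda>w. perturbed w p) z" by (simp add: sums_def)
  then show ?thesis
    unfolding perturbed_def using suminf_split_head[OF summable_dyson[OF z, of p]]
    by (simp add: sums_unique[symmetric] algebra_simps)
qed

lemma perturbed_0 [simp]: "perturbed 0 p = p"
  using perturbed_integral_equation[of 0 p] by simp

end

section \<open>Semigroup law and generator of the perturbed family\<close>

context sectorial_perturbation
begin

lemma duhamel_of_real:
  assumes r: "0 \<le> r"
  shows "duhamel f (of_real r) = integral {0..r} (\<lambda>\<sigma>. V (of_real (r - \<sigma>)) (K (f (of_real \<sigma>))))"
proof (cases "r = 0")
  case False
  with r have r: "0 < r" by simp
  let ?F = "\<lambda>\<sigma>. V (of_real (r - \<sigma>)) (K (f (of_real \<sigma>)))"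
  have "(\<lambda>x. x / r) ` {0..r} = {0..1}" using r by (simp add: image_divide_atLeastAtMost)
  with integral_stretch_real[of r 0 r ?F] r
  have "integral {0..1} (\<lambda>s. ?F (r * s)) = (1 / r) *\<^sub>R integral {0..r} ?F" by simp
  then have "r *\<^sub>R integral {0..1} (\<lambda>s. ?F (r * s)) = integral {0..r} ?F" using r by simp
  then show ?thesis
    by (simp add: duhamel_def integral_cmul[symmetric] algebra_simps del: integral_cmul)
qed simp

lemma duhamel_real_integrable:
  assumes f: "continuous_on sector0 f" and r: "0 \<le> r"
  shows "(\<lambda>\<sigma>. V (of_real (r - \<sigma>)) (K (f (of_real \<sigma>)))) integrable_on {0..r}"
proof -
  have "r - \<sigma> \<ge> 0 \<Longrightarrow> complex_of_real r - of_real \<sigma> \<in> sector0" for \<sigma>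
    using sector0_of_real[of "r - \<sigma>"] by simp
  then show ?thesis
    by (intro integrable_continuous_real continuous_on_V bounded_linear.continuous_on[OF K_linear]
        continuous_on_compose2[OF f] continuous_intros) auto
qed

text \<open>Gronwall's lemma in iterated form: the factorial estimate holds for every \<open>j\<close>, and its right-hand
  side tends to \<open>0\<close>.\<close>

lemma duhamel_fixed_point_zero:
  assumes d: "continuous_on sector0 d" and eq: "\<And>t. 0 \<le> t \<Longrightarrow> d (of_real t) = duhamel d (of_real t)"
    and t: "0 \<le> t"
  shows "d (of_real t) = 0"
proof -
  have "compact ((\<lambda>s. d (of_real s)) ` {0..t})"
    by (intro compact_continuous_image compact_Icc continuous_on_compose2[OF d] continuous_intros) auto
  then have "bounded ((\<lambda>s. d (of_real s)) ` {0..t})" by (rule compact_imp_bounded)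
  then obtain B where B: "\<And>s. s \<in> {0..t} \<Longrightarrow> norm (d (of_real s)) \<le> B"
    unfolding bounded_iff by (metis imageI)
  define C where "C = growth t * onorm K"
  have le: "norm (d (of_real s)) \<le> B * (C * s) ^ j / fact j" if "s \<in> {0..t}" for s j
    using that
  proof (induction j arbitrary: s)
    case 0
    then show ?case using B by simp
  next
    case (Suc j)
    have "norm (duhamel d (of_real s))
        \<le> B * (growth t * onorm K * cmod (of_real s)) ^ Suc j / fact (Suc j)"
    proof (rule duhamel_power_step[OF d])
      fix \<sigma> :: real assume \<sigma>: "0 \<le> \<sigma>" "\<sigma> \<le> 1"
      have "s * \<sigma> \<in> {0..t}" using Suc.prems \<sigma> mult_left_le[of \<sigma> s] by auto
      from Suc.IH[OF this] show "norm (d (of_real s * of_real \<sigma>))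
          \<le> B * (growth t * onorm K * cmod (of_real s * of_real \<sigma>)) ^ j / fact j"
        using Suc.prems \<sigma> by (simp add: C_def norm_mult)
    qed (use Suc.prems in auto)
    then show ?case using Suc.prems eq[of s] by (simp add: C_def)
  qed
  have "(\<lambda>j. (C * t) ^ j / fact j) \<longlonglongrightarrow> 0"
    using summable_LIMSEQ_zero[OF summable_exp[of "C * t"]] by (simp add: divide_inverse mult.commute)
  from tendsto_mult_right_zero[OF this, of B]
  have "(\<lambda>j. B * (C * t) ^ j / fact j) \<longlonglongrightarrow> 0" by simp
  then have "norm (d (of_real t)) \<le> 0"
    by (rule LIMSEQ_le_const) (use le[of t] t in auto)
  then show ?thesis by simp
qed

text \<open>The integral over \<open>[0,s+t]\<close> is split at \<open>t\<close>. The first part combines with \<open>V(s)V(t)p\<close> to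
  \<open>V(s)\<close> applied to the solution at time \<open>t\<close>; the second is a Duhamel integral of the shifted solution.\<close>

lemma perturbed_shift_equation:
  assumes s: "0 \<le> s" and t: "0 \<le> t"
  shows "perturbed (of_real s + of_real t) p
    = V (of_real s) (perturbed (of_real t) p) + duhamel (\<lambda>w. perturbed (w + of_real t) p) (of_real s)"
proof -
  let ?u = "\<lambda>w. perturbed w p"
  let ?F = "\<lambda>\<sigma>. V (of_real (s + t - \<sigma>)) (K (?u (of_real \<sigma>)))"
  have int: "?F integrable_on {0..s + t}"
    by (rule duhamel_real_integrable[OF continuous_on_perturbed]) (use s t in simp)
  have first: "integral {0..t} ?F = V (of_real s) (duhamel ?u (of_real t))"
  proof -
    have "V (of_real s) (duhamel ?u (of_real t))
        = integral {0..t} (V (of_real s) \<circ> (\<lambda>\<sigma>. V (of_real (t - \<sigma>)) (K (?u (of_real \<sigma>)))))"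
      unfolding duhamel_of_real[OF t]
      by (rule integral_linear[OF duhamel_real_integrable[OF continuous_on_perturbed t] V_linear, symmetric])
         (use s in simp)
    also have "\<dots> = integral {0..t} ?F"
    proof (rule integral_cong)
      fix \<sigma> assume "\<sigma> \<in> {0..t}"
      then have "V (of_real s + of_real (t - \<sigma>)) q = V (of_real s) (V (of_real (t - \<sigma>)) q)" for q
        using s by (intro V_add sector0_of_real) auto
      then show "(V (of_real s) \<circ> (\<lambda>\<sigma>. V (of_real (t - \<sigma>)) (K (?u (of_real \<sigma>))))) \<sigma> = ?F \<sigma>"
        by (simp add: algebra_simps)
    qed
    finally show ?thesis by simp
  qed
  have "integral {t - t..s + t - t} (\<lambda>\<sigma>. ?F (\<sigma> + t)) = integral {t..s + t} ?F"
    by (rule integral_shift_real_ivl)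
  then have second: "integral {t..s + t} ?F = duhamel (\<lambda>w. perturbed (w + of_real t) p) (of_real s)"
    by (simp add: duhamel_of_real[OF s])
  have st: "of_real s + of_real t = complex_of_real (s + t)" by simp
  have "perturbed (of_real s + of_real t) p
      = V (of_real s + of_real t) p + duhamel ?u (of_real (s + t))"
    unfolding st by (rule perturbed_integral_equation) (use s t in \<open>simp del: of_real_add\<close>)
  also have "duhamel ?u (of_real (s + t)) = integral {0..s + t} ?F"
    using s t by (intro duhamel_of_real) auto
  also have "\<dots> = integral {0..t} ?F + integral {t..s + t} ?F"
    by (rule Henstock_Kurzweil_Integration.integral_combine[symmetric, OF _ _ int]) (use s t in auto)
  also have "V (of_real s + of_real t) p = V (of_real s) (V (of_real t) p)"
    using s t by (intro V_add) auto
  finally have "perturbed (of_real s + of_real t) p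
      = V (of_real s) (V (of_real t) p + duhamel ?u (of_real t))
        + duhamel (\<lambda>w. perturbed (w + of_real t) p) (of_real s)"
    using s unfolding first second by (simp add: linear_simps[OF V_linear])
  then show ?thesis
    using perturbed_integral_equation[of "of_real t" p] t by simp
qed

text \<open>Both sides solve, as functions of \<open>s\<close>, Duhamel's equation with the same initial value.\<close>

lemma perturbed_semigroup_real:
  assumes s: "0 \<le> s" and t: "0 \<le> t"
  shows "perturbed (of_real s + of_real t) p = perturbed (of_real s) (perturbed (of_real t) p)"
proof -
  define f where "f w = perturbed (w + of_real t) p" for w
  define g where "g w = perturbed w (perturbed (of_real t) p)" for w
  have f: "continuous_on sector0 f"
    unfolding f_def
    by (rule continuous_on_compose2[OF continuous_on_perturbed])
       (use t in \<open>auto intro!: continuous_intros sector0_add\<close>)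
  have g: "continuous_on sector0 g" unfolding g_def by (rule continuous_on_perturbed)
  have "f (of_real s) - g (of_real s) = 0"
  proof (rule duhamel_fixed_point_zero[OF continuous_on_diff[OF f g] _ s])
    fix r :: real assume r: "0 \<le> r"
    have "f (of_real r) = V (of_real r) (perturbed (of_real t) p) + duhamel f (of_real r)"
      using perturbed_shift_equation[OF r t, of p] by (simp add: f_def[abs_def])
    moreover have "g (of_real r) = V (of_real r) (perturbed (of_real t) p) + duhamel g (of_real r)"
      using perturbed_integral_equation[of "of_real r"] r by (simp add: g_def[abs_def])
    ultimately show "f (of_real r) - g (of_real r) = duhamel (\<lambda>w. f w - g w) (of_real r)"
      using r by (simp add: duhamel_diff[OF f g])
  qed
  then show ?thesis by (simp add: f_def g_def)
qed

text \<open>The identity theorem is applied twice: first in \<open>z\<close> with the other time real, then in \<open>w\<close> with \<open>z\<close>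
  fixed.\<close>

lemma perturbed_semigroup:
  assumes z: "z \<in> sector \<theta>" and w: "w \<in> sector \<theta>"
  shows "perturbed (z + w) p = perturbed z (perturbed w p)"
proof -
  have real: "perturbed (x + of_real t) p = perturbed x (perturbed (of_real t) p)"
    if t: "0 < t" and x: "x \<in> sector \<theta>" for x t
  proof (rule eq_on_sector[OF _ _ _ x])
    show "\<exists>d. has_cplx_deriv (\<lambda>z. perturbed (z + of_real t) p) d y" if "y \<in> sector \<theta>" for y
      using perturbed_deriv[OF sector_add[OF angle that sector_of_real[OF angle t]]]
        has_cplx_deriv_shift by blast
    show "\<exists>d. has_cplx_deriv (\<lambda>z. perturbed z (perturbed (of_real t) p)) d y" if "y \<in> sector \<theta>" for y
      by (rule perturbed_deriv[OF that])
    show "perturbed (of_real s + of_real t) p = perturbed (of_real s) (perturbed (of_real t) p)"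
      if "0 < s" for s using that t by (intro perturbed_semigroup_real) auto
  qed
  have zc: "z \<in> sector0" using z sector_subset_sector0 by blast
  have "perturbed (w + z) p = perturbed z (perturbed w p)"
  proof (rule eq_on_sector[OF _ _ _ w])
    show "\<exists>d. has_cplx_deriv (\<lambda>w. perturbed (w + z) p) d y" if "y \<in> sector \<theta>" for y
      using perturbed_deriv[OF sector_add[OF angle that z]] has_cplx_deriv_shift by blast
    show "\<exists>d. has_cplx_deriv (\<lambda>w. perturbed z (perturbed w p)) d y" if "y \<in> sector \<theta>" for y
      using perturbed_deriv[OF that, of p]
        has_cplx_deriv_linear[OF perturbed_linear[OF zc] perturbed_scale[OF zc]] by blast
    show "perturbed (of_real t + z) p = perturbed z (perturbed (of_real t) p)" if "0 < t" for t
      using real[OF that z] by (simp add: add.commute)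
  qed
  then show ?thesis by (simp add: add.commute)
qed

lemma perturbed_at_0: "((\<lambda>z. perturbed z p) \<longlongrightarrow> p) (at 0 within sector \<theta>)"
proof -
  have "((\<lambda>z. perturbed z p) \<longlongrightarrow> perturbed 0 p) (at 0 within sector0)"
    using continuous_on_perturbed[of p] zero_in_sector0 unfolding continuous_on_def by (rule bspec)
  then show ?thesis
    using tendsto_within_subset[OF _ sector_subset_sector0] by simp
qed

text \<open>An invariant closed subspace, given as a kernel, stays invariant. With the second projection as \<open>L\<close> this
  shows that at real times the perturbed family preserves the real subspace \<open>'a \<times> {0}\<close>.\<close>

lemma perturbed_in_kernel:
  fixes L :: "'a \<times> 'a \<Rightarrow> 'b::banach"
  assumes L: "bounded_linear L"
    and V: "\<And>t p. 0 \<le> t \<Longrightarrow> L p = 0 \<Longrightarrow> L (V (of_real t) p) = 0"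
    and K: "\<And>p. L p = 0 \<Longrightarrow> L (K p) = 0"
    and p: "L p = 0" and t: "0 \<le> t"
  shows "L (perturbed (of_real t) p) = 0"
proof -
  have "0 \<le> t \<Longrightarrow> L (dyson j p (of_real t)) = 0" for j t
  proof (induction j arbitrary: t)
    case (Suc j)
    have "L (dyson (Suc j) p (of_real t))
        = integral {0..t} (L \<circ> (\<lambda>\<sigma>. V (of_real (t - \<sigma>)) (K (dyson j p (of_real \<sigma>)))))"
      unfolding dyson.simps duhamel_of_real[OF Suc.prems]
      by (rule integral_linear[OF duhamel_real_integrable[OF continuous_on_dyson Suc.prems] L, symmetric])
    also have "\<dots> = integral {0..t} (\<lambda>\<sigma>. 0)"
    proof (rule integral_cong)
      fix \<sigma> assume "\<sigma> \<in> {0..t}"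
      then show "(L \<circ> (\<lambda>\<sigma>. V (of_real (t - \<sigma>)) (K (dyson j p (of_real \<sigma>))))) \<sigma> = 0"
        unfolding o_def by (intro V K Suc.IH) auto
    qed
    finally show ?case by simp
  qed (simp only: dyson.simps V p)
  then show ?thesis
    unfolding perturbed_def using t summable_dyson[of "of_real t" p]
    by (simp add: bounded_linear.suminf[OF L])
qed

text \<open>The difference quotient is the average of \<open>V (t(1-s)) (K (S (ts) p))\<close> over \<open>s\<close>, which is continuous up to \<open>t = 0\<close>. So the
  generator changes by exactly \<open>K\<close>, with the same domain.\<close>

lemma perturbed_minus_V:
  "((\<lambda>t. (perturbed (of_real t) p - V (of_real t) p) /\<^sub>R t) \<longlongrightarrow> K p) (at_right 0)"
proof -
  define I where "I t = integral {0..1}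
    (\<lambda>s. V (of_real (t * (1 - s))) (K (perturbed (of_real (t * s)) p)))" for t
  have "continuous_on ({0..} \<times> {0..1}) (\<lambda>(t, s). V (of_real (t * (1 - s))) (K (perturbed (of_real (t * s)) p)))"
    unfolding split_beta
    by (intro continuous_on_V bounded_linear.continuous_on[OF K_linear]
        continuous_on_compose2[OF continuous_on_perturbed] continuous_intros)
       (auto simp del: of_real_mult of_real_diff)
  then have "continuous_on {0..} I"
    using integral_continuous_on_param[of "{0..}" 0 1 "\<lambda>t s. V (of_real (t * (1 - s))) (K (perturbed (of_real (t * s)) p))"]
    unfolding I_def[abs_def] cbox_interval by blast
  then have "(I \<longlongrightarrow> I 0) (at 0 within {0..})" by (auto simp: continuous_on_def)
  then have "(I \<longlongrightarrow> I 0) (at_right 0)" by (rule tendsto_within_subset) auto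
  moreover have "I 0 = K p" by (simp add: I_def)
  moreover have "\<forall>\<^sub>F t in at_right 0. I t = (perturbed (of_real t) p - V (of_real t) p) /\<^sub>R t"
    unfolding eventually_at_filter
  proof (intro always_eventually allI impI)
    fix t :: real assume "t \<in> {0<..}"
    then have t: "0 < t" by simp
    have "duhamel (\<lambda>w. perturbed w p) (of_real t) = t *\<^sub>R I t"
      by (simp add: duhamel_def I_def integral_cmul)
    then show "I t = (perturbed (of_real t) p - V (of_real t) p) /\<^sub>R t"
      using perturbed_integral_equation[of "of_real t" p] t by simp
  qed
  ultimately show ?thesis by (simp add: tendsto_cong)
qed

end

lemma analytic_semigroup_sectorial:
  fixes T :: "real \<Rightarrow> 'a::{real_inner, banach} \<Rightarrow> 'a"
  assumes T: "analytic_semigroup T"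
  shows "\<exists>\<theta> V. sectorial_semigroup \<theta> V \<and>
    (\<forall>t\<ge>0. \<forall>x y. V (complex_of_real t) (x, y) = (T t x, T t y))"
proof -
  have T0: "T 0 = id" using T by (simp add: analytic_semigroup_def C0_semigroup_def)
  obtain \<theta> V where angle: "0 < \<theta>" "\<theta> \<le> pi / 2"
    and V_lin: "\<forall>z\<in>sector \<theta>. bounded_linear (V z) \<and> (\<forall>c p. V z (cplx_scale c p) = cplx_scale c (V z p))"
    and V_real: "\<forall>t\<ge>0. \<forall>x y. V (complex_of_real t) (x, y) = (T t x, T t y)"
    and V_add: "\<forall>z\<in>sector \<theta>. \<forall>w\<in>sector \<theta>. V (z + w) = V z \<circ> V w"
    and V_der: "\<forall>p. \<forall>z\<in>sector \<theta>. \<exists>d. ((\<lambda>z. V z p) has_derivative (\<lambda>h. cplx_scale h d)) (at z)"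
    and V_lim: "\<forall>p. ((\<lambda>z. V z p) \<longlongrightarrow> p) (at 0 within sector \<theta>)"
    using T unfolding analytic_semigroup_def by (elim conjE exE) (rule that; assumption)
  have "sectorial_semigroup \<theta> V"
  proof (rule sectorial_semigroup.intro)
    show "0 < \<theta>" "\<theta> \<le> pi / 2" by (rule angle)+
    show "V 0 p = p" for p
      using V_real[rule_format, of 0 "fst p" "snd p"] by (simp add: T0)
    show "bounded_linear (V z)" if "z \<in> sector \<theta>" for z using V_lin that by blast
    show "V z (cplx_scale c p) = cplx_scale c (V z p)" if "z \<in> sector \<theta>" for z c p
      using V_lin that by blast
    show "V (z + w) p = V z (V w p)" if "z \<in> sector \<theta>" "w \<in> sector \<theta>" for z w p
      using V_add that by (metis comp_apply)
    show "\<exists>d. has_cplx_deriv (\<lambda>z. V z p) d z" if "z \<in> sector \<theta>" for z p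
      using V_der that unfolding has_cplx_deriv_iff by blast
    show "((\<lambda>z. V z p) \<longlongrightarrow> p) (at 0 within sector \<theta>)" for p using V_lim by blast
  qed
  with V_real show ?thesis by blast
qed

text \<open>The perturbed family on the complexification restricts at real times to a semigroup on \<open>'a\<close>, because
  \<open>K\<close> acts on both components separately.\<close>

theorem analytic_semigroup_bounded_perturbation:
  fixes T :: "real \<Rightarrow> 'a::{real_inner, banach} \<Rightarrow> 'a"
  assumes T: "analytic_semigroup T" and K: "bounded_linear K"
  shows "\<exists>S. analytic_semigroup S \<and> generator S = {(x, y + K x) | x y. (x, y) \<in> generator T}"
proof -
  obtain \<theta> V where V: "sectorial_semigroup \<theta> V"
    and V_real: "\<And>t x y. 0 \<le> t \<Longrightarrow> V (complex_of_real t) (x, y) = (T t x, T t y)"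
    using analytic_semigroup_sectorial[OF T] by blast
  note angle = sectorial_semigroup.angle[OF V]
  have C0: "C0_semigroup T" using T by (simp add: analytic_semigroup_def)
  then have T_zero: "T t 0 = 0" if "0 \<le> t" for t
    using that linear_simps(3) unfolding C0_semigroup_def by blast
  define KC where "KC p = (K (fst p), K (snd p))" for p
  interpret sectorial_perturbation \<theta> V KC
  proof (intro sectorial_perturbation.intro V sectorial_perturbation_axioms.intro)
    show "bounded_linear KC"
      unfolding KC_def
      by (intro bounded_linear_Pair bounded_linear_compose[OF K, unfolded o_def]
          bounded_linear_fst bounded_linear_snd)
    show "KC (cplx_scale c p) = cplx_scale c (KC p)" for c p
      by (simp add: KC_def cplx_scale_def linear_simps[OF K])
  qed
  define S where "S t x = fst (perturbed (of_real t) (x, 0))" for t x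
  have real0: "perturbed (of_real t) (x, 0) = (S t x, 0)" if "0 \<le> t" for t x
  proof -
    have "snd (perturbed (of_real t) (x, 0)) = 0"
    proof (rule perturbed_in_kernel[OF bounded_linear_snd])
      show "snd (V (of_real t) p) = 0" if "0 \<le> t" "snd p = 0" for t p
      proof -
        have "p = (fst p, 0)" using that(2) by (simp add: prod_eq_iff)
        then have "V (of_real t) p = (T t (fst p), T t 0)" using V_real[OF that(1)] by metis
        then show ?thesis using T_zero[OF that(1)] by simp
      qed
    qed (use that in \<open>auto simp: KC_def linear_simps[OF K]\<close>)
    then show ?thesis by (simp add: S_def prod_eq_iff)
  qed
  have real: "perturbed (of_real t) (x, y) = (S t x, S t y)" if t: "0 \<le> t" for t x y
  proof -
    have "(x, y) = (x, 0) + cplx_scale \<i> (y, 0)" by (simp add: cplx_scale_def)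
    then show ?thesis
      using t by (simp only: perturbed_add perturbed_scale sector0_of_real real0) (simp add: cplx_scale_def)
  qed
  have C0_S: "C0_semigroup S"
    unfolding C0_semigroup_def
  proof (intro conjI allI impI)
    show "bounded_linear (S t)" if "0 \<le> t" for t
    proof -
      have "bounded_linear (\<lambda>x. fst (perturbed (of_real t) (x, 0)))"
        by (intro bounded_linear_compose[OF bounded_linear_fst]
            bounded_linear_compose[OF perturbed_linear] bounded_linear_Pair bounded_linear_ident bounded_linear_zero)
           (use that in simp)
      then show ?thesis by (simp add: S_def[abs_def])
    qed
    show "S 0 = id" by (simp add: S_def fun_eq_iff)
    show "S (s + t) = S s \<circ> S t" if "0 \<le> s" "0 \<le> t" for s t
      using perturbed_semigroup_real[OF that] real0[OF that(2)]
      by (simp add: S_def fun_eq_iff flip: of_real_add)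
    show "((\<lambda>t. S t x) \<longlongrightarrow> x) (at_right 0)" for x
    proof -
      have "filterlim complex_of_real (at 0 within sector \<theta>) (at_right 0)"
        unfolding filterlim_at
        by (auto simp: eventually_at_filter sector_of_real[OF angle] intro!: tendsto_eq_intros)
      from tendsto_fst[OF filterlim_compose[OF perturbed_at_0 this, of "(x, 0)"]]
      show ?thesis by (simp add: S_def)
    qed
  qed
  have "analytic_semigroup S"
    unfolding analytic_semigroup_def
  proof (intro conjI exI[of _ \<theta>] exI[of _ perturbed] allI ballI impI)
    show "0 < \<theta>" "\<theta> \<le> pi / 2" by (rule angle)+
    show "perturbed (of_real t) (x, y) = (S t x, S t y)" if "0 \<le> t" for t x y by (rule real[OF that])
    fix z p assume z: "z \<in> sector \<theta>"
    then have zc: "z \<in> sector0" using sector_subset_sector0 by blast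
    show "bounded_linear (perturbed z)" by (rule perturbed_linear[OF zc])
    show "perturbed z (cplx_scale c p) = cplx_scale c (perturbed z p)" for c by (rule perturbed_scale[OF zc])
    show "perturbed (z + w) = perturbed z \<circ> perturbed w" if "w \<in> sector \<theta>" for w
      using perturbed_semigroup[OF z that] by (simp only: fun_eq_iff comp_apply simp_thms)
    show "\<exists>d. ((\<lambda>z. perturbed z p) has_derivative (\<lambda>h. cplx_scale h d)) (at z)"
      using perturbed_deriv[OF z] unfolding has_cplx_deriv_iff .
  qed (rule C0_S perturbed_at_0)+
  moreover have "generator S = {(x, y + K x) | x y. (x, y) \<in> generator T}"
  proof -
    have diff: "((\<lambda>t. (S t x - x) /\<^sub>R t - (T t x - x) /\<^sub>R t) \<longlongrightarrow> K x) (at_right 0)" for x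
    proof -
      have "((\<lambda>t. fst ((perturbed (of_real t) (x, 0) - V (of_real t) (x, 0)) /\<^sub>R t)) \<longlongrightarrow> K x) (at_right 0)"
        using tendsto_fst[OF perturbed_minus_V[of "(x, 0)"]] by (simp add: KC_def)
      then show ?thesis
      proof (rule Lim_transform_eventually)
        show "\<forall>\<^sub>F t in at_right 0. fst ((perturbed (of_real t) (x, 0) - V (of_real t) (x, 0)) /\<^sub>R t)
            = (S t x - x) /\<^sub>R t - (T t x - x) /\<^sub>R t"
          by (auto simp: eventually_at_filter real V_real scaleR_diff_right[symmetric] intro!: always_eventually)
      qed
    qed
    have "((\<lambda>t. (S t x - x) /\<^sub>R t) \<longlongrightarrow> y + K x) (at_right 0) \<longleftrightarrow>
        ((\<lambda>t. (T t x - x) /\<^sub>R t) \<longlongrightarrow> y) (at_right 0)" for x y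
    proof
      assume "((\<lambda>t. (S t x - x) /\<^sub>R t) \<longlongrightarrow> y + K x) (at_right 0)"
      from tendsto_diff[OF this diff[of x]] show "((\<lambda>t. (T t x - x) /\<^sub>R t) \<longlongrightarrow> y) (at_right 0)" by simp
    next
      assume "((\<lambda>t. (T t x - x) /\<^sub>R t) \<longlongrightarrow> y) (at_right 0)"
      from tendsto_add[OF this diff[of x]] show "((\<lambda>t. (S t x - x) /\<^sub>R t) \<longlongrightarrow> y + K x) (at_right 0)" by simp
    qed
    then have mem: "(x, y + K x) \<in> generator S \<longleftrightarrow> (x, y) \<in> generator T" for x y
      by (simp add: generator_def)
    show ?thesis
    proof (intro set_eqI iffI)
      fix q assume q: "q \<in> generator S"
      obtain x z where xz: "q = (x, z)" by fastforce
      then have "(x, z - K x) \<in> generator T" using q mem[of x "z - K x"] by simp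
      then show "q \<in> {(x, y + K x) | x y. (x, y) \<in> generator T}" using xz by force
    qed (use mem in auto)
  qed
  ultimately show ?thesis by blast
qed

section \<open>Exponential stability from a quadratic Lyapunov function\<close>

text \<open>Analyticity makes every orbit differentiable for positive times, whatever its initial value. This
  spares a density argument when the Lyapunov function is differentiated along orbits.\<close>

lemma analytic_semigroup_orbit_derivative:
  fixes S :: "real \<Rightarrow> 'a::{real_inner, banach} \<Rightarrow> 'a"
  assumes S: "analytic_semigroup S" and t: "0 < t"
  shows "\<exists>y. (S t x, y) \<in> generator S \<and> ((\<lambda>t. S t x) has_vector_derivative y) (at t)"
proof -
  obtain \<theta> V where V: "sectorial_semigroup \<theta> V"
    and V_real: "\<And>t x y. 0 \<le> t \<Longrightarrow> V (complex_of_real t) (x, y) = (S t x, S t y)"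
    using analytic_semigroup_sectorial[OF S] by blast
  interpret sectorial_semigroup \<theta> V by (rule V)
  obtain d where d: "has_cplx_deriv (\<lambda>z. V z (x, 0)) d (of_real t)"
    using V_deriv sector_of_real[OF angle t] by blast
  have "(of_real has_derivative complex_of_real) (at t)"
    by (auto intro!: derivative_eq_intros)
  from has_derivative_compose[OF this d[unfolded has_cplx_deriv_iff]]
  have "((\<lambda>r. V (of_real r) (x, 0)) has_derivative (\<lambda>h. h *\<^sub>R d)) (at t)" by simp
  from has_derivative_fst[OF this]
  have "((\<lambda>r. fst (V (of_real r) (x, 0))) has_vector_derivative fst d) (at t)"
    by (simp add: has_vector_derivative_def)
  then have deriv: "((\<lambda>t. S t x) has_vector_derivative fst d) (at t)"
    by (rule has_vector_derivative_transform_within_open[of _ _ _ "{0<..}"]) (use t V_real in auto)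
  have "((\<lambda>h. norm (S (t + h) x - S t x - h *\<^sub>R fst d) / norm h) \<longlongrightarrow> 0) (at 0)"
    using deriv by (simp add: has_vector_derivative_def has_derivative_at)
  then have "((\<lambda>h. norm (S (t + h) x - S t x - h *\<^sub>R fst d) / norm h) \<longlongrightarrow> 0) (at_right 0)"
    by (rule tendsto_within_subset) simp
  moreover have "\<forall>\<^sub>F h in at_right 0. norm (S (t + h) x - S t x - h *\<^sub>R fst d) / norm h
      = norm ((S h (S t x) - S t x) /\<^sub>R h - fst d)"
    unfolding eventually_at_filter
  proof (intro always_eventually allI impI)
    fix h :: real assume "h \<in> {0<..}"
    then have h: "0 < h" by simp
    have "S (h + t) = S h \<circ> S t"
      using S h t by (simp add: analytic_semigroup_def C0_semigroup_def)
    then have "(S h (S t x) - S t x) /\<^sub>R h - fst d = (S (t + h) x - S t x - h *\<^sub>R fst d) /\<^sub>R h"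
      using h by (simp add: add.commute scaleR_diff_right)
    then show "norm (S (t + h) x - S t x - h *\<^sub>R fst d) / norm h
        = norm ((S h (S t x) - S t x) /\<^sub>R h - fst d)"
      using h by (simp add: divide_inverse mult.commute)
  qed
  ultimately have "((\<lambda>h. norm ((S h (S t x) - S t x) /\<^sub>R h - fst d)) \<longlongrightarrow> 0) (at_right 0)"
    by (rule Lim_transform_eventually)
  from LIM_zero_cancel[OF tendsto_norm_zero_cancel[OF this]]
  have "((\<lambda>h. (S h (S t x) - S t x) /\<^sub>R h) \<longlongrightarrow> fst d) (at_right 0)" .
  with deriv show ?thesis by (auto simp: generator_def)
qed

text \<open>Along an orbit \<open>h(t) = (u(t), R u(t))\<close> satisfies \<open>h' \<le> - |u|\<^sup>2 \<le> - h / c\<close>, so \<open>h\<close> decays like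
  \<open>exp (- t / c)\<close>. Since \<open>R\<close> need not be coercive, \<open>|u|\<close> is recovered from the dissipation: \<open>|u(t)| \<le> M |u(s)|\<close>
  for \<open>t - 1 \<le> s \<le> t\<close>, so that \<open>h\<close> falls by at least \<open>|u(t)|\<^sup>2 / M\<^sup>2\<close> on \<open>[t-1,t]\<close>, and \<open>h(t) \<ge> 0\<close>.\<close>

theorem lyapunov_exp_stable:
  fixes S :: "real \<Rightarrow> 'a::{real_inner, banach} \<Rightarrow> 'a"
  assumes S: "analytic_semigroup S" and R: "bounded_linear R"
    and sym: "\<And>u v. inner (R u) v = inner u (R v)" and pos: "\<And>u. 0 \<le> inner u (R u)"
    and lyap: "\<And>u y. (u, y) \<in> generator S \<Longrightarrow> 2 * inner y (R u) \<le> - (norm u)\<^sup>2"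
  shows "exp_stable S"
proof -
  obtain c where c: "0 < c" "\<And>u. norm (R u) \<le> norm u * c"
    using bounded_linear.pos_bounded[OF R] by blast
  have L_le: "inner u (R u) \<le> c * (norm u)\<^sup>2" for u
  proof -
    have "inner u (R u) \<le> norm u * norm (R u)" by (rule norm_cauchy_schwarz)
    also have "\<dots> \<le> norm u * (norm u * c)" by (intro mult_left_mono c) simp
    finally show ?thesis by (simp add: power2_eq_square mult_ac)
  qed
  have "\<exists>M>0. \<forall>t x. 0 \<le> t \<longrightarrow> t \<le> 2 \<longrightarrow> norm (S t x) \<le> M * norm x"
  proof -
    obtain \<theta> V where V: "sectorial_semigroup \<theta> V"
      and V_real: "\<And>t x y. 0 \<le> t \<Longrightarrow> V (complex_of_real t) (x, y) = (S t x, S t y)"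
      using analytic_semigroup_sectorial[OF S] by blast
    interpret sectorial_semigroup \<theta> V by (rule V)
    have "norm (S t x) \<le> growth 2 * norm x" if "0 \<le> t" "t \<le> 2" for t x
    proof -
      have "norm (S t x) \<le> norm (V (of_real t) (x, 0))"
        using norm_fst_le[of "S t x" "S t 0"] by (simp add: V_real that)
      also have "\<dots> \<le> growth 2 * norm (x, 0 :: 'a)" by (rule norm_V_le) (use that in auto)
      finally show ?thesis by (simp add: norm_Pair)
    qed
    then show ?thesis using growth_pos[of 2] by blast
  qed
  then obtain M where M: "0 < M" "\<And>t x. 0 \<le> t \<Longrightarrow> t \<le> 2 \<Longrightarrow> norm (S t x) \<le> M * norm x"
    by blast
  have decay: "(norm (S t x))\<^sup>2 \<le> (M\<^sup>2 * (c * M\<^sup>2) + M\<^sup>2) * exp ((2 - t) / c) * (norm x)\<^sup>2"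
    if t: "0 \<le> t" for t x
  proof (cases "t \<le> 2")
    case True
    have "(norm (S t x))\<^sup>2 \<le> (M * norm x)\<^sup>2" using M t True by (intro power_mono) auto
    also have "\<dots> = M\<^sup>2 * 1 * (norm x)\<^sup>2" by (simp add: power_mult_distrib)
    also have "\<dots> \<le> (M\<^sup>2 * (c * M\<^sup>2) + M\<^sup>2) * exp ((2 - t) / c) * (norm x)\<^sup>2"
      using M c True by (intro mult_right_mono mult_mono) auto
    finally show ?thesis .
  next
    case False
    define h where "h s = inner (S s x) (R (S s x))" for s
    have h_deriv: "\<exists>D. (h has_real_derivative D) (at s) \<and> D \<le> - (norm (S s x))\<^sup>2" if s: "0 < s" for s
    proof -
      obtain y where y: "(S s x, y) \<in> generator S" "((\<lambda>t. S t x) has_vector_derivative y) (at s)"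
        using analytic_semigroup_orbit_derivative[OF S s] by blast
      have "(h has_vector_derivative (inner (S s x) (R y) + inner y (R (S s x)))) (at s)"
        unfolding h_def
        by (intro bounded_bilinear.has_vector_derivative[OF bounded_bilinear_inner]
            bounded_linear.has_vector_derivative[OF R] y)
      moreover have "inner (S s x) (R y) = inner y (R (S s x))"
        by (metis sym inner_commute)
      ultimately have "(h has_real_derivative 2 * inner y (R (S s x))) (at s)"
        by (simp add: has_real_derivative_iff_has_vector_derivative)
      then show ?thesis using lyap[OF y(1)] by blast
    qed
    \<comment> \<open>The orbit may fail to be differentiable at time \<open>0\<close>, so the comparison starts at a positive time.\<close>
    have h_decay: "exp (r / c) * h r \<le> exp (s / c) * h s" if "0 < s" "s \<le> r" for s r
    proof (rule DERIV_nonpos_imp_nonincreasing[where f = "\<lambda>r. exp (r / c) * h r", OF that(2)])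
      fix q assume "s \<le> q" "q \<le> r"
      then obtain D where D: "(h has_real_derivative D) (at q)" "D \<le> - (norm (S q x))\<^sup>2"
        using h_deriv[of q] \<open>0 < s\<close> by auto
      have "((\<lambda>r. exp (r / c) * h r) has_real_derivative exp (q / c) * (h q / c + D)) (at q)"
        using c(1) by (auto intro!: derivative_eq_intros D(1) simp: algebra_simps)
      moreover have "h q / c \<le> (norm (S q x))\<^sup>2"
        using L_le[of "S q x"] c(1) unfolding h_def by (simp only: pos_divide_le_eq mult.commute)
      then have "exp (q / c) * (h q / c + D) \<le> 0"
        using D(2) by (intro mult_nonneg_nonpos) auto
      ultimately show "\<exists>y. ((\<lambda>r. exp (r / c) * h r) has_real_derivative y) (at q) \<and> y \<le> 0" by blast
    qed
    \<comment> \<open>A lower bound for \<open>|u|\<^sup>2\<close> on the whole interval \<open>[t-1,t]\<close>.\<close>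
    define \<kappa> where "\<kappa> = (norm (S t x))\<^sup>2 / M\<^sup>2"
    have "h t + \<kappa> * t \<le> h (t - 1) + \<kappa> * (t - 1)"
    proof (rule DERIV_nonpos_imp_nonincreasing[where f = "\<lambda>r. h r + \<kappa> * r"])
      fix q assume q: "t - 1 \<le> q" "q \<le> t"
      then have q0: "0 < q" using False by simp
      then obtain D where D: "(h has_real_derivative D) (at q)" "D \<le> - (norm (S q x))\<^sup>2"
        using h_deriv[of q] by auto
      have "S t = S (t - q) \<circ> S q"
        using S q q0 unfolding analytic_semigroup_def C0_semigroup_def
        by (metis diff_add_cancel diff_ge_0_iff_ge less_imp_le)
      then have "norm (S t x) \<le> M * norm (S q x)" using M(2)[of "t - q" "S q x"] q by simp
      then have "(norm (S t x))\<^sup>2 \<le> (M * norm (S q x))\<^sup>2" by (rule power_mono) simp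
      then have "\<kappa> \<le> (norm (S q x))\<^sup>2" using M(1) by (simp add: \<kappa>_def field_simps)
      moreover have "((\<lambda>r. h r + \<kappa> * r) has_real_derivative D + \<kappa>) (at q)"
        by (auto intro!: derivative_eq_intros D(1))
      ultimately show "\<exists>y. ((\<lambda>r. h r + \<kappa> * r) has_real_derivative y) (at q) \<and> y \<le> 0"
        using D(2) by (intro exI[of _ "D + \<kappa>"]) simp
    qed simp
    moreover have "0 \<le> h t" unfolding h_def by (rule pos)
    ultimately have "\<kappa> \<le> h (t - 1)" by (simp add: algebra_simps)
    then have "(norm (S t x))\<^sup>2 \<le> M\<^sup>2 * h (t - 1)" using M(1) by (simp add: \<kappa>_def field_simps)
    also have "h (t - 1) \<le> exp ((2 - t) / c) * h 1"
    proof -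
      have "h (t - 1) = exp (- (t - 1) / c) * (exp ((t - 1) / c) * h (t - 1))"
        by (simp flip: exp_add mult.assoc add_divide_distrib)
      also have "\<dots> \<le> exp (- (t - 1) / c) * (exp (1 / c) * h 1)"
        using h_decay[of 1 "t - 1"] False by (intro mult_left_mono) auto
      also have "\<dots> = exp ((2 - t) / c) * h 1"
        by (simp flip: exp_add mult.assoc add_divide_distrib)
      finally show ?thesis .
    qed
    also have "h 1 \<le> c * (M * norm x)\<^sup>2"
    proof -
      have "(norm (S 1 x))\<^sup>2 \<le> (M * norm x)\<^sup>2" using M(2)[of 1 x] by (intro power_mono) auto
      then show ?thesis
        using L_le[of "S 1 x"] c(1) unfolding h_def by (meson mult_left_mono less_imp_le order_trans)
    qed
    finally have "(norm (S t x))\<^sup>2 \<le> M\<^sup>2 * (exp ((2 - t) / c) * (c * (M * norm x)\<^sup>2))"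
      by (simp add: mult_left_mono)
    also have "\<dots> = M\<^sup>2 * (c * M\<^sup>2) * (exp ((2 - t) / c) * (norm x)\<^sup>2)"
      by (simp add: power_mult_distrib mult_ac)
    also have "\<dots> \<le> (M\<^sup>2 * (c * M\<^sup>2) + M\<^sup>2) * (exp ((2 - t) / c) * (norm x)\<^sup>2)"
      by (intro mult_right_mono) auto
    finally show ?thesis by (simp only: mult.assoc)
  qed
  define C where "C = (M\<^sup>2 * (c * M\<^sup>2) + M\<^sup>2) * exp (2 / c)"
  have C: "0 < C" using M(1) c(1) by (auto simp: C_def intro!: mult_pos_pos add_pos_pos)
  have "norm (S t x) \<le> sqrt C * exp (- (1 / (2 * c)) * t) * norm x" if "0 \<le> t" for t x
  proof (rule power2_le_imp_le)
    have half: "(exp (- (1 / (2 * c)) * t))\<^sup>2 = exp (- t / c)"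
      by (simp add: power2_eq_square flip: exp_add)
    have "exp ((2 - t) / c) = exp (2 / c) * exp (- t / c)"
      by (simp add: diff_divide_distrib flip: exp_add)
    then have "(norm (S t x))\<^sup>2 \<le> C * exp (- t / c) * (norm x)\<^sup>2"
      using decay[OF that, of x] by (simp only: C_def mult.assoc)
    also have "\<dots> = (sqrt C * exp (- (1 / (2 * c)) * t) * norm x)\<^sup>2"
      using C by (simp only: power_mult_distrib half real_sqrt_pow2 less_imp_le)
    finally show "(norm (S t x))\<^sup>2 \<le> (sqrt C * exp (- (1 / (2 * c)) * t) * norm x)\<^sup>2" .
    show "0 \<le> sqrt C * exp (- (1 / (2 * c)) * t) * norm x" using C by simp
  qed
  moreover have "0 < sqrt C" "0 < 1 / (2 * c)" using C c(1) by simp_all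
  ultimately show ?thesis unfolding exp_stable_def by blast
qed

section \<open>The linearised shell model and its closed loop\<close>

text \<open>Each of the four terms of \<open>B\<close> is a shift of \<open>u\<close> times a coefficient \<open>k\<^sub>i v\<^sub>j\<close> with \<open>i \<le> j + 1\<close>. For
  \<open>n = 1\<close> the truncated index \<open>n - 2 = 0\<close> respects this relation too.\<close>

lemma sabra_B_in_l2_seqs:
  assumes k: "\<And>i j. i \<le> Suc j \<Longrightarrow> cmod (ell2_seq v j) * \<bar>k i\<bar> \<le> D"
  shows "sabra_B k a b (ell2_seq u) (ell2_seq v) \<in> l2_seqs"
    and "sabra_B k a b (ell2_seq v) (ell2_seq u) \<in> l2_seqs"
proof -
  define E where "E = (\<bar>a\<bar> + \<bar>b\<bar>) * D"
  define s where "s n = cmod (ell2_seq u (n + 2)) + cmod (ell2_seq u (n + 1))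
      + cmod (ell2_seq u (n - 1)) + cmod (ell2_seq u (n - 2))" for n
  have D: "0 \<le> D" using k[of 0 0] by simp
  then have E: "0 \<le> E" by (simp add: E_def)
  have coef: "\<bar>d\<bar> * \<bar>k i\<bar> * cmod (ell2_seq v j) * x \<le> E * s n"
    if "i \<le> Suc j" "\<bar>d\<bar> \<le> \<bar>a\<bar> + \<bar>b\<bar>" "0 \<le> x" "x \<le> s n" for d i j x n
  proof -
    have "\<bar>d\<bar> * (cmod (ell2_seq v j) * \<bar>k i\<bar>) \<le> E"
      unfolding E_def using that k[OF that(1)] D by (intro mult_mono) auto
    from mult_mono[OF this that(4) E that(3)] show ?thesis by (simp add: mult_ac)
  qed
  have s_ge: "cmod (ell2_seq u (n + 2)) \<le> s n" "cmod (ell2_seq u (n + 1)) \<le> s n"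
    "cmod (ell2_seq u (n - 1)) \<le> s n" "cmod (ell2_seq u (n - 2)) \<le> s n" for n
    by (auto simp: s_def)
  have four: "(x1 + x2 + x3 + x4)\<^sup>2 \<le> 4 * (x1\<^sup>2 + x2\<^sup>2 + x3\<^sup>2 + x4\<^sup>2)" for x1 x2 x3 x4 :: real
    using sum_squares_bound[of x1 x2] sum_squares_bound[of x1 x3] sum_squares_bound[of x1 x4]
      sum_squares_bound[of x2 x3] sum_squares_bound[of x2 x4] sum_squares_bound[of x3 x4]
    by (simp add: power2_eq_square algebra_simps)
  have "summable (\<lambda>n. 4 * ((cmod (ell2_seq u (n + 2)))\<^sup>2 + (cmod (ell2_seq u (n + 1)))\<^sup>2
      + (cmod (ell2_seq u (n - 1)))\<^sup>2 + (cmod (ell2_seq u (n - 2)))\<^sup>2))"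
  proof (intro summable_mult summable_add)
    let ?f = "\<lambda>n. (cmod (ell2_seq u n))\<^sup>2"
    have f: "summable ?f" by (rule summable_ell2_seq)
    show "summable (\<lambda>n. ?f (n + 2))" "summable (\<lambda>n. ?f (n + 1))"
      by (rule summable_ignore_initial_segment[OF f])+
    show "summable (\<lambda>n. ?f (n - 1))"
      using f summable_iff_shift[of "\<lambda>n. ?f (n - 1)" 1] by simp
    show "summable (\<lambda>n. ?f (n - 2))"
      using f summable_iff_shift[of "\<lambda>n. ?f (n - 2)" 2] by simp
  qed
  then have "summable (\<lambda>n. (s n)\<^sup>2)"
    by (rule summable_comparison_test'[of _ 0]) (use four in \<open>simp add: s_def\<close>)
  then have sum: "summable (\<lambda>n. (4 * E)\<^sup>2 * (s n)\<^sup>2)" by (rule summable_mult)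
  have l2: "f \<in> l2_seqs" if f0: "f 0 = 0" and f: "\<And>n. 0 < n \<Longrightarrow> cmod (f n) \<le> 4 * E * s n" for f
  proof -
    have "(cmod (f n))\<^sup>2 \<le> (4 * E)\<^sup>2 * (s n)\<^sup>2" if "0 < n" for n
      using power_mono[OF f[OF that] norm_ge_zero, of 2] by (simp only: power_mult_distrib)
    then have "summable (\<lambda>n. (cmod (f n))\<^sup>2)"
      by (intro summable_comparison_test'[OF sum, of 1]) auto
    with f0 show ?thesis by (simp add: l2_seqs_def)
  qed
  have tri: "cmod (- \<i> * (x1 + x2 + x3 + x4)) \<le> 4 * E * r"
    if "cmod x1 \<le> E * r" "cmod x2 \<le> E * r" "cmod x3 \<le> E * r" "cmod x4 \<le> E * r" for x1 x2 x3 x4 r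
    using that norm_triangle_ineq[of "x1 + x2 + x3" x4] norm_triangle_ineq[of "x1 + x2" x3]
      norm_triangle_ineq[of x1 x2]
    by (simp add: norm_mult)
  have coefs: "\<bar>a\<bar> \<le> \<bar>a\<bar> + \<bar>b\<bar>" "\<bar>b\<bar> \<le> \<bar>a\<bar> + \<bar>b\<bar>" by auto
  show "sabra_B k a b (ell2_seq u) (ell2_seq v) \<in> l2_seqs"
  proof (rule l2)
    fix n :: nat assume n: "0 < n"
    have "cmod (- \<i> * (of_real (a * k (n + 1)) * ell2_seq v (n + 2) * cnj (ell2_seq u (n + 1))
             + of_real (b * k n) * ell2_seq v (n + 1) * cnj (ell2_seq u (n - 1))
             + of_real (a * k (n - 1)) * ell2_seq u (n - 1) * ell2_seq v (n - 2)
             + of_real (b * k (n - 1)) * ell2_seq v (n - 1) * ell2_seq u (n - 2))) \<le> 4 * E * s n"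
    proof (rule tri)
      show "cmod (of_real (a * k (n + 1)) * ell2_seq v (n + 2) * cnj (ell2_seq u (n + 1))) \<le> E * s n"
        using coef[OF _ coefs(1) norm_ge_zero s_ge(2)[of n], of "n + 1" "n + 2"] by (simp add: norm_mult abs_mult)
      show "cmod (of_real (b * k n) * ell2_seq v (n + 1) * cnj (ell2_seq u (n - 1))) \<le> E * s n"
        using coef[OF _ coefs(2) norm_ge_zero s_ge(3)[of n], of "n" "n + 1"] by (simp add: norm_mult abs_mult)
      show "cmod (of_real (a * k (n - 1)) * ell2_seq u (n - 1) * ell2_seq v (n - 2)) \<le> E * s n"
        using coef[OF _ coefs(1) norm_ge_zero s_ge(3)[of n], of "n - 1" "n - 2"] by (simp add: norm_mult abs_mult mult_ac)
      show "cmod (of_real (b * k (n - 1)) * ell2_seq v (n - 1) * ell2_seq u (n - 2)) \<le> E * s n"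
        using coef[OF _ coefs(2) norm_ge_zero s_ge(4)[of n], of "n - 1" "n - 1"] by (simp add: norm_mult abs_mult)
    qed
    then show "cmod (sabra_B k a b (ell2_seq u) (ell2_seq v) n) \<le> 4 * E * s n"
      using n by (simp add: sabra_B_def)
  qed (simp add: sabra_B_def)
  show "sabra_B k a b (ell2_seq v) (ell2_seq u) \<in> l2_seqs"
  proof (rule l2)
    fix n :: nat assume n: "0 < n"
    have "cmod (- \<i> * (of_real (a * k (n + 1)) * ell2_seq u (n + 2) * cnj (ell2_seq v (n + 1))
             + of_real (b * k n) * ell2_seq u (n + 1) * cnj (ell2_seq v (n - 1))
             + of_real (a * k (n - 1)) * ell2_seq v (n - 1) * ell2_seq u (n - 2)
             + of_real (b * k (n - 1)) * ell2_seq u (n - 1) * ell2_seq v (n - 2))) \<le> 4 * E * s n"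
    proof (rule tri)
      show "cmod (of_real (a * k (n + 1)) * ell2_seq u (n + 2) * cnj (ell2_seq v (n + 1))) \<le> E * s n"
        using coef[OF _ coefs(1) norm_ge_zero s_ge(1)[of n], of "n + 1" "n + 1"] by (simp add: norm_mult abs_mult mult_ac)
      show "cmod (of_real (b * k n) * ell2_seq u (n + 1) * cnj (ell2_seq v (n - 1))) \<le> E * s n"
        using coef[OF _ coefs(2) norm_ge_zero s_ge(2)[of n], of "n" "n - 1"] n by (simp add: norm_mult abs_mult mult_ac)
      show "cmod (of_real (a * k (n - 1)) * ell2_seq v (n - 1) * ell2_seq u (n - 2)) \<le> E * s n"
        using coef[OF _ coefs(1) norm_ge_zero s_ge(4)[of n], of "n - 1" "n - 1"] by (simp add: norm_mult abs_mult)
      show "cmod (of_real (b * k (n - 1)) * ell2_seq u (n - 1) * ell2_seq v (n - 2)) \<le> E * s n"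
        using coef[OF _ coefs(2) norm_ge_zero s_ge(3)[of n], of "n - 1" "n - 2"] by (simp add: norm_mult abs_mult mult_ac)
    qed
    then show "cmod (sabra_B k a b (ell2_seq v) (ell2_seq u) n) \<le> 4 * E * s n"
      using n by (simp add: sabra_B_def)
  qed (simp add: sabra_B_def)
qed

text \<open>The wave numbers grow geometrically, so \<open>k\<^sub>i \<le> \<lambda> k\<^sub>j\<close> for \<open>i \<le> j + 1\<close>; and \<open>k\<^sub>j v\<^sub>j\<close> is bounded by
  \<open>k\<^sub>j\<^sup>2 v\<^sub>j / k\<^sub>0\<close>, where \<open>k\<^sub>j\<^sup>2 v\<^sub>j\<close> are the coordinates of \<open>Av\<close>.\<close>

lemma dom_A_weighted_bound:
  assumes lam: "lam > 1" and k0: "k0 > 0" and k: "\<And>n. k n = k0 * lam ^ n" and v: "v \<in> dom_A k"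
  shows "\<exists>D. \<forall>i j. i \<le> Suc j \<longrightarrow> cmod (ell2_seq v j) * \<bar>k i\<bar> \<le> D"
proof -
  define w where "w = Abs_ell2 (sabra_A k (ell2_seq v))"
  have w: "ell2_seq w = sabra_A k (ell2_seq v)"
    unfolding w_def by (rule Abs_ell2_inverse) (use v in \<open>simp add: dom_A_def\<close>)
  have "cmod (ell2_seq v j) * \<bar>k i\<bar> \<le> lam / k0 * norm w" if "i \<le> Suc j" for i j
  proof -
    have kj: "k0 \<le> k j" "0 < k j" using lam k0 by (simp_all add: k)
    have "\<bar>k i\<bar> \<le> lam * k j"
      using power_increasing[OF that, of lam] lam k0 by (simp add: k)
    then have "cmod (ell2_seq v j) * \<bar>k i\<bar> \<le> cmod (ell2_seq v j) * (lam * k j)"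
      by (rule mult_left_mono) simp
    also have "\<dots> \<le> cmod (ell2_seq v j) * (lam * k j) * (k j / k0)"
    proof -
      have "1 \<le> k j / k0" using kj k0 by simp
      from mult_left_mono[OF this, of "cmod (ell2_seq v j) * (lam * k j)"] show ?thesis
        using lam kj by simp
    qed
    also have "\<dots> = lam / k0 * cmod (ell2_seq w j)"
      by (simp add: w sabra_A_def norm_mult power2_eq_square)
    also have "\<dots> \<le> lam / k0 * norm w"
      using lam k0 by (intro mult_left_mono cmod_ell2_seq_le) auto
    finally show ?thesis .
  qed
  then show ?thesis by blast
qed

text \<open>No \<open>u\<close> outside \<open>D(A)\<close> enters the maximal domain through cancellation: if the sum lies in \<open>H\<close>, then so
  does \<open>Au\<close>, as all the other terms do.\<close>

lemma closed_loop_op_eq: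
  assumes \<nu>: "\<nu> > 0" and lam: "lam > 1" and k0: "k0 > 0" and k: "\<And>n. k n = k0 * lam ^ n"
    and ue: "ue \<in> dom_A k"
  shows "closed_loop_op k a b \<nu> ue B1 R
    = {(u, y + B1 (adjoint B1 (R u))) | u y. (u, y) \<in> lin_op k a b \<nu> ue}"
proof (intro set_eqI iffI)
  fix p assume p: "p \<in> closed_loop_op k a b \<nu> ue B1 R"
  obtain u q where uq: "p = (u, q)" by fastforce
  define y where "y = q - B1 (adjoint B1 (R u))"
  have y: "ell2_seq y n = lin_coord k a b \<nu> ue (ell2_seq u) n" for n
    using p by (simp add: uq closed_loop_op_def y_def minus_ell2_rep)
  obtain D where D: "\<And>i j. i \<le> Suc j \<Longrightarrow> cmod (ell2_seq ue j) * \<bar>k i\<bar> \<le> D"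
    using dom_A_weighted_bound[OF lam k0 k ue] by blast
  have "sabra_A k (ell2_seq u) = (\<lambda>n. of_real (1 / \<nu>) * (ell2_seq y n
      + - 1 * (sabra_B k a b (ell2_seq u) (ell2_seq ue) n + sabra_B k a b (ell2_seq ue) (ell2_seq u) n)))"
    using \<nu> by (simp add: fun_eq_iff y lin_coord_def)
  also have "\<dots> \<in> l2_seqs"
    by (intro l2_seqs_scale l2_seqs_add ell2_seq sabra_B_in_l2_seqs[where v = ue, OF D])
  finally have "(u, y) \<in> lin_op k a b \<nu> ue" by (simp add: lin_op_def dom_A_def y)
  then show "p \<in> {(u, y + B1 (adjoint B1 (R u))) | u y. (u, y) \<in> lin_op k a b \<nu> ue}"
    using uq by (force simp: y_def)
qed (auto simp: closed_loop_op_def lin_op_def plus_ell2.rep_eq)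

theorem proposition4p17:
  fixes lam k0 \<nu> a b c \<gamma> \<gamma>0 :: real
    and k :: "nat \<Rightarrow> real"
    and f ue :: ell2
    and B1 B2 R :: "ell2 \<Rightarrow> ell2"
    and T :: "real \<Rightarrow> ell2 \<Rightarrow> ell2"
  assumes "lam > 1" and "k0 > 0" and "\<nu> > 0" and "a + b + c = 0"
    and k: "\<And>n. k n = k0 * lam ^ n"
    and ue: "stationary_solution k a b \<nu> f ue"
    and T: "analytic_semigroup T" "generator T = op_uminus (lin_op k a b \<nu> ue)"
    and B: "bounded_linear B1" "bounded_linear B2"
    and \<gamma>0: "game_threshold T B1 B2 \<gamma>0"
    and \<gamma>: "\<gamma> > \<gamma>0"
    and R: "value_operator T B1 B2 \<gamma> R"
    and R_pos: "\<And>u. 0 \<le> inner u (R u)"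
    and R_riccati: "riccati (lin_op k a b \<nu> ue) B1 B2 \<gamma> R"
  shows "\<exists>S. analytic_semigroup S \<and> exp_stable S \<and>
             generator S = op_uminus (closed_loop_op k a b \<nu> ue B1 R)"
proof -
  have R_lin: "bounded_linear R" and R_sym: "\<And>u v. inner (R u) v = inner u (R v)"
    using R by (auto simp: value_operator_def)
  have \<gamma>_pos: "0 < \<gamma>" using \<gamma>0 \<gamma> by (auto simp: game_threshold_def)
  define K where "K u = B1 (adjoint B1 (R u))" for u
  have "bounded_linear (\<lambda>u. - K u)"
    unfolding K_def
    by (intro bounded_linear_minus bounded_linear_compose[OF B(1)]
        bounded_linear_compose[OF bounded_linear_adjoint[OF B(1)]] R_lin)
  from analytic_semigroup_bounded_perturbation[OF T(1) this]
  obtain S where S: "analytic_semigroup S"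
    and gen: "generator S = {(u, y + - K u) | u y. (u, y) \<in> generator T}" by blast
  have ue_dom: "ue \<in> dom_A k" using ue by (simp add: stationary_solution_def)
  have gen_S: "generator S = op_uminus (closed_loop_op k a b \<nu> ue B1 R)"
    unfolding closed_loop_op_eq[OF assms(3,1,2) k ue_dom] gen T(2) op_uminus_def K_def[symmetric]
    by force
  have "exp_stable S"
  proof (rule lyapunov_exp_stable[OF S R_lin R_sym R_pos])
    fix u q assume "(u, q) \<in> generator S"
    then obtain y where y: "(u, y) \<in> lin_op k a b \<nu> ue" and q: "q = - y - K u"
      unfolding gen T(2) op_uminus_def by auto
    define b1 where "b1 = adjoint B1 (R u)"
    define b2 where "b2 = adjoint B2 (R u)"
    obtain z where z: "(R u, z) \<in> op_adjoint (lin_op k a b \<nu> ue)"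
      and eq: "z + R y + R (B1 b1) - (1 / \<gamma>) *\<^sub>R R (B2 b2) - u = 0"
      using R_riccati y unfolding riccati_def b1_def b2_def by blast
    \<comment> \<open>The Riccati equation is paired with \<open>u\<close>; both \<open>\<A>\<^sup>*\<R>\<close> and \<open>\<R>\<A>\<close> give \<open>(\<A>u,\<R>u)\<close>.\<close>
    have "inner u z = inner y (R u)" using z y by (auto simp: op_adjoint_def)
    moreover have "inner u (R y) = inner y (R u)" by (metis R_sym inner_commute)
    moreover have KR: "inner (B1 b1) (R u) = (norm b1)\<^sup>2" "inner (B2 b2) (R u) = (norm b2)\<^sup>2"
      unfolding b1_def b2_def power2_norm_eq_inner
      by (simp_all add: inner_adjoint[OF B(1), symmetric] inner_adjoint[OF B(2), symmetric])
    moreover have "inner u (R (B1 b1)) = inner (B1 b1) (R u)" "inner u (R (B2 b2)) = inner (B2 b2) (R u)"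
      by (metis R_sym inner_commute)+
    moreover have "inner u (z + R y + R (B1 b1) - (1 / \<gamma>) *\<^sub>R R (B2 b2) - u) = 0" unfolding eq by simp
    ultimately have "2 * inner y (R u) + (norm b1)\<^sup>2 - (norm b2)\<^sup>2 / \<gamma> - (norm u)\<^sup>2 = 0"
      by (simp add: inner_add_right inner_diff_right power2_norm_eq_inner)
    moreover have "inner q (R u) = - inner y (R u) - (norm b1)\<^sup>2"
      using KR(1) by (simp add: q K_def b1_def inner_diff_left)
    moreover have "0 \<le> (norm b2)\<^sup>2 / \<gamma>" using \<gamma>_pos by simp
    moreover have "0 \<le> (norm b1)\<^sup>2" by simp
    ultimately show "2 * inner q (R u) \<le> - (norm u)\<^sup>2" by argo
  qed
  with S gen_S show ?thesis by blast
qed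

end
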